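(* Let $G$ be a compact, Hausdorff, second countable topological group, and let $m(G)$ be a positive integer such that every non-trivial complex continuous representation of $G$ has dimension at least $m(G)$. Let $A,B\subseteq G$ be two measurable sets. Then \[ \|1_A\ast 1_B-\mu(A)\mu(B)\|_2\le \sqrt{\frac{\mu(A)\mu(B)}{m(G)}}. \]
   Context: $\mu$ is the (bi-invariant) Haar measure on $G$ normalized by $\mu(G)=1$, $\|\cdot\|_2$ is the norm of $L^2(G,\mu)$, and $1_A$ is the characteristic function of $A$. Convolution is $(f_1\ast f_2)(x)=\int_G f_1(xy^{-1})f_2(y)\,d\mu(y)$. The number $\mu(A)\mu(B)$ is regarded as a constant function on $G$. Representations are finite-dimensional; a representation is non-trivial if it is not the constant homomorphism to the identity. *)

theory Defs
  imports
    "HOL-Analysis.Analysis"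
    "HOL-Algebra.Coset"
    "Jordan_Normal_Form.Matrix"
begin

locale topological_group = group G
  for G :: "('a, 'b) monoid_scheme" (structure) and T :: "'a topology" +
  assumes topspace_eq: "topspace T = carrier G"
    and continuous_mult: "continuous_map (prod_topology T T) T (\<lambda>(x, y). x \<otimes> y)"
    and continuous_inv: "continuous_map T T (\<lambda>x. inv x)"

text \<open>
  The normalized bi-invariant Haar measure of a compact Hausdorff second countable group, as a
  measure on the Borel sets. Regularity is not required separately: such a group is
  metrizable, so every finite Borel measure on it is regular.
\<close>

definition normalized_haar_measure ::
    "('a, 'b) monoid_scheme \<Rightarrow> 'a topology \<Rightarrow> 'a measure \<Rightarrow> bool" where
  "normalized_haar_measure G T M \<longleftrightarrow>
     space M = topspace T \<and>
     sets M = sigma_sets (topspace T) {U. openin T U} \<and>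
     emeasure M (space M) = 1 \<and>
     (\<forall>g \<in> carrier G. \<forall>A \<in> sets M.
        emeasure M (g <#\<^bsub>G\<^esub> A) = emeasure M A \<and>
        emeasure M (A #>\<^bsub>G\<^esub> g) = emeasure M A)"

definition convolution ::
    "('a, 'b) monoid_scheme \<Rightarrow> 'a measure \<Rightarrow>
      ('a \<Rightarrow> 'c :: {real_normed_algebra, banach, second_countable_topology}) \<Rightarrow>
      ('a \<Rightarrow> 'c) \<Rightarrow> 'a \<Rightarrow> 'c" where
  "convolution G M f1 f2 x =
     (\<integral>y. f1 (x \<otimes>\<^bsub>G\<^esub> inv\<^bsub>G\<^esub> y) * f2 y \<partial>M)"

text \<open>Meaningful only for measurable, square-integrable functions.\<close>

definition l2_norm ::
    "'a measure \<Rightarrow> ('a \<Rightarrow> 'c :: {real_normed_vector, second_countable_topology}) \<Rightarrow> real" where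
  "l2_norm M f = sqrt (\<integral>x. (norm (f x))\<^sup>2 \<partial>M)"

definition GL :: "nat \<Rightarrow> complex mat monoid" where
  "GL n = units_of (ring_mat TYPE(complex) n ())"

text \<open>
  An \<open>n\<close>-dimensional representation is given in coordinates; continuity into the group of
  invertible matrices, topologized as a subspace of the space of all complex matrices, is
  continuity of the matrix entries.
\<close>

definition continuous_representation ::
    "('a, 'b) monoid_scheme \<Rightarrow> 'a topology \<Rightarrow> nat \<Rightarrow> ('a \<Rightarrow> complex mat) \<Rightarrow> bool" where
  "continuous_representation G T n \<rho> \<longleftrightarrow>
     \<rho> \<in> hom G (GL n) \<and>
     (\<forall>i<n. \<forall>j<n. continuous_map T euclidean (\<lambda>g. \<rho> g $$ (i, j)))"

definition nontrivial_representation ::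
    "('a, 'b) monoid_scheme \<Rightarrow> nat \<Rightarrow> ('a \<Rightarrow> complex mat) \<Rightarrow> bool" where
  "nontrivial_representation G n \<rho> \<longleftrightarrow> (\<exists>g \<in> carrier G. \<rho> g \<noteq> 1\<^sub>m n)"

end

theory Submission
  imports Defs "HOL-Complex_Analysis.Great_Picard"
begin

text \<open>
  The convolution \<open>1\<^sub>A * 1\<^sub>B\<close> is the value at \<open>1\<^sub>B\<close> of the operator \<open>T f = 1\<^sub>A * f\<close> on \<open>L\<^sup>2(G)\<close>. It
  multiplies constants by \<open>\<mu>(A)\<close>, so that \<open>1\<^sub>A * 1\<^sub>B - \<mu>(A) \<mu>(B) = T (1\<^sub>B - \<mu>(B))\<close>. The function
  \<open>1\<^sub>B - \<mu>(B)\<close> has mean zero and squared norm at most \<open>\<mu>(B)\<close>, and it remains to see that on functions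
  of mean zero the operator norm of \<open>T\<close> satisfies \<open>\<parallel>T\<parallel>\<^sup>2 \<le> \<mu>(A) / m\<close>.

  The kernel \<open>1\<^sub>A(x y\<^sup>-\<^sup>1)\<close> of \<open>T\<close> has squared Hilbert-Schmidt norm \<open>\<mu>(A)\<close>, and this is the sum of the
  eigenvalues of \<open>T\<^sup>* T\<close> with multiplicity. Left convolution commutes with right translations, hence
  \<open>G\<close> acts by right translation on the eigenspace of \<open>T\<^sup>* T\<close>, among functions of mean zero, for its
  largest eigenvalue \<open>\<lambda> = \<parallel>T\<parallel>\<^sup>2\<close>. If \<open>\<lambda> > 0\<close>, that space is finite-dimensional and contains no invariant vector
  other than \<open>0\<close>, because invariant functions are constant. So the action is a non-trivial
  representation, its dimension is at least \<open>m\<close>, and \<open>m \<lambda> \<le> \<mu>(A)\<close>.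

  The argument is carried out for bounded Borel functions and pointwise identities. The largest
  eigenvalue is the supremum of \<open>\<parallel>T f\<parallel>\<^sup>2\<close> over the unit ball (\<open>top_eigenvalue\<close>), and
  \<open>ex_eigenfunction\<close> shows that it is attained if positive: \<open>T\<^sup>* T\<close> maps the unit ball to an equicontinuous
  family (\<open>conv_equicontinuous\<close>), as translates of a set depend continuously on the translation
  (\<open>translate_dist_tendsto\<close>). Bessel's inequality for the rows of the kernel replaces the trace
  (\<open>orthonormal_eigenspace_bound\<close>), and all of this can be done with real functions: a real
  orthonormal basis of the eigenspace gives a complex representation of the same dimension
  (\<open>ex_nontrivial_representation\<close>).
\<close>

section \<open>Bounded measurable functions and their inner product\<close>

text \<open>
  These functions stand in for \<open>L\<^sup>2\<close>: on a finite measure space they are closed under products and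
  integrable, and they have values at points, which an eigenfunction needs in order to be translated.
\<close>

definition bounded_measurable :: "'a measure \<Rightarrow> ('a \<Rightarrow> real) \<Rightarrow> bool" where
  "bounded_measurable M f \<longleftrightarrow>
     f \<in> borel_measurable M \<and> (\<exists>C. \<forall>x\<in>space M. \<bar>f x\<bar> \<le> C)"

definition inner_L2 :: "'a measure \<Rightarrow> ('a \<Rightarrow> real) \<Rightarrow> ('a \<Rightarrow> real) \<Rightarrow> real" where
  "inner_L2 M f g = (\<integral>x. f x * g x \<partial>M)"

lemma bounded_measurableI:
  "f \<in> borel_measurable M \<Longrightarrow> (\<And>x. x \<in> space M \<Longrightarrow> \<bar>f x\<bar> \<le> C) \<Longrightarrow> bounded_measurable M f"
  unfolding bounded_measurable_def by blast

lemma bounded_measurableE: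
  assumes "bounded_measurable M f"
  obtains C where "C \<ge> 0" "\<And>x. x \<in> space M \<Longrightarrow> \<bar>f x\<bar> \<le> C"
proof -
  obtain C where "\<forall>x\<in>space M. \<bar>f x\<bar> \<le> C"
    using assms unfolding bounded_measurable_def by blast
  then show thesis
    by (intro that[of "max C 0"]) (auto simp: le_max_iff_disj)
qed

lemma bounded_measurable_measurable:
  "bounded_measurable M f \<Longrightarrow> f \<in> borel_measurable M"
  by (simp add: bounded_measurable_def)

lemma bounded_measurable_const: "bounded_measurable M (\<lambda>_. c)"
  by (rule bounded_measurableI[where C = "\<bar>c\<bar>"]) auto

lemma bounded_measurable_add:
  assumes "bounded_measurable M f" "bounded_measurable M g"
  shows "bounded_measurable M (\<lambda>x. f x + g x)"
proof -
  obtain C where C: "\<And>x. x \<in> space M \<Longrightarrow> \<bar>f x\<bar> \<le> C"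
    using assms(1) by (rule bounded_measurableE) blast
  obtain D where D: "\<And>x. x \<in> space M \<Longrightarrow> \<bar>g x\<bar> \<le> D"
    using assms(2) by (rule bounded_measurableE) blast
  show ?thesis
  proof (rule bounded_measurableI[where C = "C + D"])
    show "(\<lambda>x. f x + g x) \<in> borel_measurable M"
      using assms by (auto simp: bounded_measurable_def)
    show "\<bar>f x + g x\<bar> \<le> C + D" if "x \<in> space M" for x
      using C[OF that] D[OF that] by linarith
  qed
qed

lemma bounded_measurable_mult:
  assumes "bounded_measurable M f" "bounded_measurable M g"
  shows "bounded_measurable M (\<lambda>x. f x * g x)"
proof -
  obtain C where C: "C \<ge> 0" "\<And>x. x \<in> space M \<Longrightarrow> \<bar>f x\<bar> \<le> C"
    using assms(1) by (rule bounded_measurableE) blast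
  obtain D where D: "D \<ge> 0" "\<And>x. x \<in> space M \<Longrightarrow> \<bar>g x\<bar> \<le> D"
    using assms(2) by (rule bounded_measurableE) blast
  show ?thesis
  proof (rule bounded_measurableI[where C = "C * D"])
    show "(\<lambda>x. f x * g x) \<in> borel_measurable M"
      using assms by (auto simp: bounded_measurable_def)
    show "\<bar>f x * g x\<bar> \<le> C * D" if "x \<in> space M" for x
      using C D that by (simp add: abs_mult mult_mono)
  qed
qed

lemma bounded_measurable_cmult:
  "bounded_measurable M f \<Longrightarrow> bounded_measurable M (\<lambda>x. c * f x)"
  by (intro bounded_measurable_mult bounded_measurable_const)

lemma bounded_measurable_diff:
  assumes "bounded_measurable M f" "bounded_measurable M g"
  shows "bounded_measurable M (\<lambda>x. f x - g x)"
  using bounded_measurable_add[OF assms(1) bounded_measurable_cmult[OF assms(2), of "-1"]]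
  by simp

lemma bounded_measurable_sum:
  "(\<And>i. i \<in> I \<Longrightarrow> bounded_measurable M (f i)) \<Longrightarrow> bounded_measurable M (\<lambda>x. \<Sum>i\<in>I. f i x)"
  by (induction I rule: infinite_finite_induct)
    (auto intro: bounded_measurable_const bounded_measurable_add)

lemma bounded_measurable_indicator:
  "A \<in> sets M \<Longrightarrow> bounded_measurable M (indicat_real A)"
  by (rule bounded_measurableI[where C = 1]) (auto simp: indicator_def)

lemma bounded_measurable_abs:
  "bounded_measurable M f \<Longrightarrow> bounded_measurable M (\<lambda>x. \<bar>f x\<bar>)"
  unfolding bounded_measurable_def by auto

lemmas bounded_measurable_intros =
  bounded_measurable_const bounded_measurable_add bounded_measurable_mult
  bounded_measurable_diff bounded_measurable_sum bounded_measurable_indicator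

lemma bounded_measurable_compose:
  assumes "bounded_measurable M f" "h \<in> measurable M M"
  shows "bounded_measurable M (\<lambda>x. f (h x))"
proof -
  obtain C where C: "\<And>x. x \<in> space M \<Longrightarrow> \<bar>f x\<bar> \<le> C"
    using assms(1) by (rule bounded_measurableE) blast
  show ?thesis
  proof (rule bounded_measurableI)
    show "(\<lambda>x. f (h x)) \<in> borel_measurable M"
      by (rule measurable_compose[OF assms(2) bounded_measurable_measurable[OF assms(1)]])
    show "\<bar>f (h x)\<bar> \<le> C" if "x \<in> space M" for x
      using C measurable_space[OF assms(2) that] by blast
  qed
qed

lemma inner_L2_commute: "inner_L2 M f g = inner_L2 M g f"
  by (simp add: inner_L2_def mult.commute)

lemma inner_L2_self_nonneg: "inner_L2 M f f \<ge> 0"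
  by (simp add: inner_L2_def)

lemma inner_L2_cong:
  "(\<And>x. x \<in> space M \<Longrightarrow> f x = f' x) \<Longrightarrow> (\<And>x. x \<in> space M \<Longrightarrow> g x = g' x)
    \<Longrightarrow> inner_L2 M f g = inner_L2 M f' g'"
  unfolding inner_L2_def by (rule Bochner_Integration.integral_cong) auto

lemma inner_L2_cmult: "inner_L2 M (\<lambda>x. c * f x) g = c * inner_L2 M f g"
  by (simp add: inner_L2_def mult.assoc)

lemma inner_L2_cmult_right: "inner_L2 M f (\<lambda>x. c * g x) = c * inner_L2 M f g"
  by (simp add: inner_L2_def mult.left_commute)

lemma inner_L2_cmult_both: "inner_L2 M (\<lambda>x. c * f x) (\<lambda>x. c * f x) = c\<^sup>2 * inner_L2 M f f"
  by (simp add: inner_L2_cmult inner_L2_cmult_right power2_eq_square)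

context finite_measure
begin

lemma bounded_measurable_integrable:
  assumes "bounded_measurable M f"
  shows "integrable M f"
proof -
  obtain C where C: "\<And>x. x \<in> space M \<Longrightarrow> \<bar>f x\<bar> \<le> C"
    using assms by (rule bounded_measurableE) blast
  show ?thesis
    by (rule integrable_const_bound[where B = C])
      (use C assms in \<open>auto simp: bounded_measurable_def\<close>)
qed

lemma inner_L2_diff:
  assumes "bounded_measurable M f" "bounded_measurable M f'" "bounded_measurable M g"
  shows "inner_L2 M (\<lambda>x. f x - f' x) g = inner_L2 M f g - inner_L2 M f' g"
  unfolding inner_L2_def left_diff_distrib
  by (intro Bochner_Integration.integral_diff bounded_measurable_integrable
      bounded_measurable_mult assms)

lemma inner_L2_sum:
  assumes "\<And>i. i \<in> I \<Longrightarrow> bounded_measurable M (f i)" "bounded_measurable M g"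
  shows "inner_L2 M (\<lambda>x. \<Sum>i\<in>I. f i x) g = (\<Sum>i\<in>I. inner_L2 M (f i) g)"
  unfolding inner_L2_def sum_distrib_right
  by (intro Bochner_Integration.integral_sum bounded_measurable_integrable
      bounded_measurable_mult assms)

lemma inner_L2_diff_self:
  assumes "bounded_measurable M f" "bounded_measurable M g"
  shows "inner_L2 M (\<lambda>x. f x - g x) (\<lambda>x. f x - g x)
           = inner_L2 M f f - 2 * inner_L2 M f g + inner_L2 M g g"
proof -
  note d = bounded_measurable_diff[OF assms]
  have "inner_L2 M (\<lambda>x. f x - g x) (\<lambda>x. f x - g x)
      = inner_L2 M (\<lambda>x. f x - g x) f - inner_L2 M (\<lambda>x. f x - g x) g"
    using inner_L2_diff[OF assms d] by (simp add: inner_L2_commute)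
  also have "\<dots> = inner_L2 M f f - 2 * inner_L2 M f g + inner_L2 M g g"
    using inner_L2_diff[OF assms assms(1)] inner_L2_diff[OF assms assms(2)]
    by (simp add: inner_L2_commute[of M g f])
  finally show ?thesis .
qed

lemma inner_L2_Cauchy_Schwarz:
  assumes f: "bounded_measurable M f" and g: "bounded_measurable M g"
  shows "(inner_L2 M f g)\<^sup>2 \<le> inner_L2 M f f * inner_L2 M g g"
proof -
  have *: "2 * c * inner_L2 M f g \<le> inner_L2 M f f + c\<^sup>2 * inner_L2 M g g" for c
  proof -
    have "0 \<le> inner_L2 M (\<lambda>x. f x - c * g x) (\<lambda>x. f x - c * g x)"
      by (rule inner_L2_self_nonneg)
    also have "\<dots> = inner_L2 M f f - 2 * (c * inner_L2 M f g) + c * (c * inner_L2 M g g)"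
      using inner_L2_diff_self[OF f bounded_measurable_cmult[OF g, of c]]
      by (simp add: inner_L2_cmult inner_L2_commute[of M _ "\<lambda>x. c * g x"] inner_L2_commute[of M g f])
    finally show ?thesis by (simp add: power2_eq_square algebra_simps)
  qed
  show ?thesis
  proof (cases "inner_L2 M g g = 0")
    case True
    \<comment> \<open>the quadratic in \<open>c\<close> degenerates to a bounded linear function, so its slope vanishes\<close>
    have "inner_L2 M f g = 0"
    proof (rule ccontr)
      assume nz: "inner_L2 M f g \<noteq> 0"
      have "inner_L2 M f f + 1 \<le> inner_L2 M f f"
        using *[of "(inner_L2 M f f + 1) / (2 * inner_L2 M f g)"] nz True by simp
      then show False by simp
    qed
    then show ?thesis using True by simp
  next
    case False
    then have pos: "inner_L2 M g g > 0" using inner_L2_self_nonneg[of M g] by simp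
    have "2 * (inner_L2 M f g)\<^sup>2 / inner_L2 M g g
        \<le> inner_L2 M f f + (inner_L2 M f g)\<^sup>2 / inner_L2 M g g"
      using *[of "inner_L2 M f g / inner_L2 M g g"] pos
      by (simp add: power2_eq_square power_divide field_simps)
    then have "(inner_L2 M f g)\<^sup>2 / inner_L2 M g g \<le> inner_L2 M f f" by simp
    then show ?thesis using pos by (simp add: field_simps)
  qed
qed

lemma inner_L2_Bessel:
  fixes n :: nat
  assumes f: "bounded_measurable M f"
    and e: "\<And>i. i < n \<Longrightarrow> bounded_measurable M (e i)"
    and orth: "\<And>i j. i < n \<Longrightarrow> j < n \<Longrightarrow> inner_L2 M (e i) (e j) = (if i = j then 1 else 0)"
  shows "(\<Sum>i<n. (inner_L2 M f (e i))\<^sup>2) \<le> inner_L2 M f f"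
proof -
  define p where "p = (\<lambda>x. \<Sum>i<n. inner_L2 M f (e i) * e i x)"
  have p: "bounded_measurable M p"
    unfolding p_def using e by (intro bounded_measurable_sum bounded_measurable_cmult) auto
  have ip: "inner_L2 M p g = (\<Sum>i<n. inner_L2 M f (e i) * inner_L2 M (e i) g)"
    if "bounded_measurable M g" for g
    unfolding p_def using e that
    by (subst inner_L2_sum) (auto simp: inner_L2_cmult intro: bounded_measurable_cmult)
  have fp: "inner_L2 M f p = (\<Sum>i<n. (inner_L2 M f (e i))\<^sup>2)"
    using ip[OF f] by (simp add: inner_L2_commute[of M _ f] power2_eq_square)
  have ep: "inner_L2 M (e i) p = inner_L2 M f (e i)" if "i < n" for i
  proof -
    have "inner_L2 M (e i) p = (\<Sum>j<n. if j = i then inner_L2 M f (e j) else 0)"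
      unfolding inner_L2_commute[of M "e i" p] ip[OF e[OF that]]
      by (rule sum.cong) (use that orth in auto)
    then show ?thesis using that by simp
  qed
  have "inner_L2 M p p = (\<Sum>i<n. (inner_L2 M f (e i))\<^sup>2)"
    using ip[OF p] ep by (simp add: power2_eq_square)
  with fp inner_L2_diff_self[OF f p] inner_L2_self_nonneg[of M "\<lambda>x. f x - p x"]
  show ?thesis by linarith
qed

lemma bounded_convergence:
  assumes f: "\<And>n. bounded_measurable M (f n)"
    and C: "\<And>n x. x \<in> space M \<Longrightarrow> \<bar>f n x\<bar> \<le> C"
    and lim: "\<And>x. x \<in> space M \<Longrightarrow> (\<lambda>n. f n x) \<longlonglongrightarrow> h x"
  shows "bounded_measurable M h" and "(\<lambda>n. \<integral>x. f n x \<partial>M) \<longlonglongrightarrow> (\<integral>x. h x \<partial>M)"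
proof -
  have meas: "h \<in> borel_measurable M"
    by (rule borel_measurable_LIMSEQ_metric[OF bounded_measurable_measurable[OF f] lim])
  show "bounded_measurable M h"
  proof (rule bounded_measurableI[OF meas])
    fix x assume x: "x \<in> space M"
    show "\<bar>h x\<bar> \<le> C"
      using LIMSEQ_le_const2[OF tendsto_rabs[OF lim[OF x]]] C[OF x] by blast
  qed
  show "(\<lambda>n. \<integral>x. f n x \<partial>M) \<longlonglongrightarrow> (\<integral>x. h x \<partial>M)"
  proof (rule integral_dominated_convergence[where w = "\<lambda>_. C"])
    show "AE x in M. (\<lambda>n. f n x) \<longlonglongrightarrow> h x"
      by (rule AE_I2) (rule lim)
    show "AE x in M. norm (f n x) \<le> C" for n
      unfolding real_norm_def by (rule AE_I2) (rule C)
  qed (simp_all add: meas bounded_measurable_measurable[OF f])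
qed

end

section \<open>The Haar measure\<close>

locale haar_group = topological_group G T
  for G :: "('a, 'b) monoid_scheme" (structure) and T :: "'a topology" +
  fixes M :: "'a measure"
  assumes second_countable: "second_countable T"
    and haar: "normalized_haar_measure G T M"
begin

lemma space_M: "space M = carrier G"
  using haar topspace_eq by (simp add: normalized_haar_measure_def)

lemma sets_M: "sets M = sigma_sets (carrier G) {U. openin T U}"
  using haar topspace_eq by (simp add: normalized_haar_measure_def)

lemma emeasure_M: "emeasure M (carrier G) = 1"
  using haar unfolding space_M[symmetric] normalized_haar_measure_def by blast

sublocale finite_measure M
  by standard (simp add: space_M emeasure_M)

sublocale pair: pair_sigma_finite M M
  by standard

lemma measure_M: "measure M (carrier G) = 1"
  by (simp add: measure_def emeasure_M)

lemma open_in_sets: "openin T U \<Longrightarrow> U \<in> sets M"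
  by (auto simp: sets_M)

lemma openin_subset_carrier: "openin T U \<Longrightarrow> U \<subseteq> carrier G"
  using openin_subset topspace_eq by blast

lemma measurable_into_M:
  assumes "\<And>x. x \<in> space N \<Longrightarrow> f x \<in> carrier G"
    and "\<And>U. openin T U \<Longrightarrow> f -` U \<inter> space N \<in> sets N"
  shows "f \<in> measurable N M"
  by (rule measurable_sigma_sets[OF sets_M]) (use assms openin_subset_carrier in auto)

lemma measurable_continuous:
  assumes "continuous_map T T f"
  shows "f \<in> measurable M M"
proof (rule measurable_into_M)
  show "f x \<in> carrier G" if "x \<in> space M" for x
    using assms that by (auto simp: continuous_map_def space_M topspace_eq)
  fix U assume U: "openin T U"
  have "openin T {x \<in> topspace T. f x \<in> U}"
    using assms U by (simp add: continuous_map_def)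
  moreover have "{x \<in> topspace T. f x \<in> U} = f -` U \<inter> space M"
    by (auto simp: space_M topspace_eq)
  ultimately show "f -` U \<inter> space M \<in> sets M" using open_in_sets by simp
qed

text \<open>
  Second countability makes an open subset of \<open>G \<times> G\<close> a countable union of open rectangles, so
  that it belongs to the product sigma-algebra.
\<close>

lemma open_prod_in_sets:
  assumes W: "openin (prod_topology T T) W"
  shows "W \<in> sets (M \<Otimes>\<^sub>M M)"
proof -
  obtain \<B> where \<B>: "countable \<B>" "\<forall>V\<in>\<B>. openin T V"
    and basis: "\<forall>U x. openin T U \<and> x \<in> U \<longrightarrow> (\<exists>V\<in>\<B>. x \<in> V \<and> V \<subseteq> U)"
    using second_countable unfolding second_countable_def by (elim exE conjE) (rule that)
  define \<R> where "\<R> = {(U, V) \<in> \<B> \<times> \<B>. U \<times> V \<subseteq> W}"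
  have "W = (\<Union>(U, V)\<in>\<R>. U \<times> V)"
  proof
    show "W \<subseteq> (\<Union>(U, V)\<in>\<R>. U \<times> V)"
    proof
      fix p assume p: "p \<in> W"
      obtain x y where xy: "p = (x, y)" by (cases p)
      obtain U V where "openin T U" "openin T V" "x \<in> U" "y \<in> V" and UV: "U \<times> V \<subseteq> W"
        using W p unfolding openin_prod_topology_alt xy by meson
      then obtain U' V' where "U' \<in> \<B>" "x \<in> U'" "U' \<subseteq> U" "V' \<in> \<B>" "y \<in> V'" "V' \<subseteq> V"
        using basis by meson
      with UV have "(U', V') \<in> \<R>" "(x, y) \<in> U' \<times> V'" by (auto simp: \<R>_def)
      then show "p \<in> (\<Union>(U, V)\<in>\<R>. U \<times> V)" using xy by blast
    qed
  qed (auto simp: \<R>_def)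
  moreover have "countable \<R>"
    unfolding \<R>_def using \<B>(1) by (auto intro: countable_subset[of _ "\<B> \<times> \<B>"])
  moreover have "U \<times> V \<in> sets (M \<Otimes>\<^sub>M M)" if "(U, V) \<in> \<R>" for U V
    using that \<B>(2) by (auto simp: \<R>_def intro!: pair_measureI open_in_sets)
  ultimately show ?thesis
    by (auto intro!: sets.countable_UN')
qed

lemma measurable_mult: "(\<lambda>(x, y). x \<otimes> y) \<in> measurable (M \<Otimes>\<^sub>M M) M"
proof (rule measurable_into_M)
  show "(case p of (x, y) \<Rightarrow> x \<otimes> y) \<in> carrier G" if "p \<in> space (M \<Otimes>\<^sub>M M)" for p
    using that by (auto simp: space_pair_measure space_M)
  fix U assume U: "openin T U"
  have "openin (prod_topology T T) {p \<in> topspace (prod_topology T T). (case p of (x, y) \<Rightarrow> x \<otimes> y) \<in> U}"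
    using continuous_mult U by (simp add: continuous_map_def)
  moreover have "{p \<in> topspace (prod_topology T T). (case p of (x, y) \<Rightarrow> x \<otimes> y) \<in> U}
      = (\<lambda>(x, y). x \<otimes> y) -` U \<inter> space (M \<Otimes>\<^sub>M M)"
    by (auto simp: space_pair_measure space_M topspace_eq)
  ultimately show "(\<lambda>(x, y). x \<otimes> y) -` U \<inter> space (M \<Otimes>\<^sub>M M) \<in> sets (M \<Otimes>\<^sub>M M)"
    using open_prod_in_sets by simp
qed

lemma measurable_mult_comp [measurable (raw)]:
  "f \<in> measurable N M \<Longrightarrow> g \<in> measurable N M \<Longrightarrow> (\<lambda>x. f x \<otimes> g x) \<in> measurable N M"
  by (rule measurable_compose[OF measurable_Pair measurable_mult, unfolded prod.case])

lemma measurable_inv [measurable]: "(\<lambda>x. inv x) \<in> measurable M M"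
  by (rule measurable_continuous[OF continuous_inv])

lemma measurable_const_M: "g \<in> carrier G \<Longrightarrow> (\<lambda>_. g) \<in> measurable N M"
  by (simp add: space_M)

lemma measurable_right_translate: "g \<in> carrier G \<Longrightarrow> (\<lambda>x. x \<otimes> g) \<in> measurable M M"
  by (intro measurable_mult_comp measurable_const_M measurable_ident_sets[OF refl])

lemma measurable_left_translate: "g \<in> carrier G \<Longrightarrow> (\<lambda>x. g \<otimes> x) \<in> measurable M M"
  by (intro measurable_mult_comp measurable_const_M measurable_ident_sets[OF refl])

lemma distr_right_translate:
  assumes g: "g \<in> carrier G"
  shows "distr M M (\<lambda>x. x \<otimes> g) = M"
proof (rule measure_eqI)
  note meas = measurable_right_translate[OF g]
  fix E assume "E \<in> sets (distr M M (\<lambda>x. x \<otimes> g))"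
  then have E: "E \<in> sets M" by simp
  then have EG: "E \<subseteq> carrier G" using sets.sets_into_space space_M by blast
  have "(\<lambda>x. x \<otimes> g) -` E \<inter> space M = E #> inv g"
  proof (intro equalityI subsetI)
    fix x assume x: "x \<in> (\<lambda>x. x \<otimes> g) -` E \<inter> space M"
    then have "x = (x \<otimes> g) \<otimes> inv g" using g by (simp add: space_M m_assoc)
    then show "x \<in> E #> inv g" using x by (auto simp: r_coset_def)
  next
    fix x assume "x \<in> E #> inv g"
    then obtain e where "e \<in> E" "x = e \<otimes> inv g" by (auto simp: r_coset_def)
    then show "x \<in> (\<lambda>x. x \<otimes> g) -` E \<inter> space M"
      using EG g by (auto simp: space_M m_assoc)
  qed
  then show "emeasure (distr M M (\<lambda>x. x \<otimes> g)) E = emeasure M E"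
    using haar E g meas by (simp add: emeasure_distr normalized_haar_measure_def)
qed simp

lemma distr_left_translate:
  assumes g: "g \<in> carrier G"
  shows "distr M M (\<lambda>x. g \<otimes> x) = M"
proof (rule measure_eqI)
  note meas = measurable_left_translate[OF g]
  fix E assume "E \<in> sets (distr M M (\<lambda>x. g \<otimes> x))"
  then have E: "E \<in> sets M" by simp
  then have EG: "E \<subseteq> carrier G" using sets.sets_into_space space_M by blast
  have "(\<lambda>x. g \<otimes> x) -` E \<inter> space M = inv g <# E"
  proof (intro equalityI subsetI)
    fix x assume x: "x \<in> (\<lambda>x. g \<otimes> x) -` E \<inter> space M"
    then have "x = inv g \<otimes> (g \<otimes> x)" using g by (simp add: space_M m_assoc[symmetric])
    then show "x \<in> inv g <# E" using x by (auto simp: l_coset_def)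
  next
    fix x assume "x \<in> inv g <# E"
    then obtain e where "e \<in> E" "x = inv g \<otimes> e" by (auto simp: l_coset_def)
    then show "x \<in> (\<lambda>x. g \<otimes> x) -` E \<inter> space M"
      using EG g by (auto simp: space_M m_assoc[symmetric])
  qed
  then show "emeasure (distr M M (\<lambda>x. g \<otimes> x)) E = emeasure M E"
    using haar E g meas by (simp add: emeasure_distr normalized_haar_measure_def)
qed simp

text \<open>
  Averaging over \<open>y\<close> the identity \<open>\<mu>(E\<^sup>-\<^sup>1) = \<integral> 1\<^sub>E (x\<^sup>-\<^sup>1 y) dx\<close>, which is left invariance, and
  exchanging the integrals turns the right-hand side into \<open>\<mu>(E)\<close>.
\<close>

lemma distr_inv: "distr M M (\<lambda>x. inv x) = M"
proof (rule measure_eqI)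
  fix E assume "E \<in> sets (distr M M (\<lambda>x. inv x))"
  then have E [measurable]: "E \<in> sets M" by simp
  have shift: "(\<integral>\<^sup>+x. indicator E (inv x) \<partial>M) = (\<integral>\<^sup>+x. indicator E (inv x \<otimes> y) \<partial>M)"
    if y: "y \<in> carrier G" for y
  proof -
    have yi: "inv y \<in> carrier G" using y by simp
    note [measurable] = measurable_left_translate[OF yi]
    have "(\<integral>\<^sup>+x. indicator E (inv x) \<partial>M)
        = (\<integral>\<^sup>+x. indicator E (inv x) \<partial>distr M M (\<lambda>x. inv y \<otimes> x))"
      by (simp add: distr_left_translate[OF yi])
    also have "\<dots> = (\<integral>\<^sup>+x. indicator E (inv (inv y \<otimes> x)) \<partial>M)"
      by (subst nn_integral_distr) auto
    also have "\<dots> = (\<integral>\<^sup>+x. indicator E (inv x \<otimes> y) \<partial>M)"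
      by (rule nn_integral_cong) (use y in \<open>simp add: space_M inv_mult_group\<close>)
    finally show ?thesis .
  qed
  have "emeasure (distr M M (\<lambda>x. inv x)) E = (\<integral>\<^sup>+x. indicator E (inv x) \<partial>M)"
    using nn_integral_distr[of "\<lambda>x. inv x" M M "indicator E"] E by simp
  also have "\<dots> = (\<integral>\<^sup>+y. (\<integral>\<^sup>+x. indicator E (inv x) \<partial>M) \<partial>M)"
    by (simp add: space_M emeasure_M)
  also have "\<dots> = (\<integral>\<^sup>+y. (\<integral>\<^sup>+x. indicator E (inv x \<otimes> y) \<partial>M) \<partial>M)"
    by (rule nn_integral_cong, rule shift) (simp add: space_M)
  also have "\<dots> = (\<integral>\<^sup>+x. (\<integral>\<^sup>+y. indicator E (inv x \<otimes> y) \<partial>M) \<partial>M)"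
    by (rule pair.Fubini') measurable
  also have "\<dots> = (\<integral>\<^sup>+x. emeasure M E \<partial>M)"
  proof (rule nn_integral_cong)
    fix x assume "x \<in> space M"
    then have xi: "inv x \<in> carrier G" by (simp add: space_M)
    note [measurable] = measurable_left_translate[OF xi]
    have "(\<integral>\<^sup>+y. indicator E (inv x \<otimes> y) \<partial>M) = (\<integral>\<^sup>+y. indicator E y \<partial>distr M M (\<lambda>y. inv x \<otimes> y))"
      by (subst nn_integral_distr) auto
    also have "\<dots> = emeasure M E" by (simp add: distr_left_translate[OF xi])
    finally show "(\<integral>\<^sup>+y. indicator E (inv x \<otimes> y) \<partial>M) = emeasure M E" .
  qed
  also have "\<dots> = emeasure M E" by (simp add: space_M emeasure_M)
  finally show "emeasure (distr M M (\<lambda>x. inv x)) E = emeasure M E" .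
qed simp

lemma integral_right_translate:
  assumes "g \<in> carrier G" "(f :: 'a \<Rightarrow> real) \<in> borel_measurable M"
  shows "(\<integral>x. f (x \<otimes> g) \<partial>M) = (\<integral>x. f x \<partial>M)"
  using integral_distr[OF measurable_right_translate[OF assms(1)] assms(2)]
  by (simp add: distr_right_translate[OF assms(1)])

lemma integral_left_translate:
  assumes "g \<in> carrier G" "(f :: 'a \<Rightarrow> real) \<in> borel_measurable M"
  shows "(\<integral>x. f (g \<otimes> x) \<partial>M) = (\<integral>x. f x \<partial>M)"
  using integral_distr[OF measurable_left_translate[OF assms(1)] assms(2)]
  by (simp add: distr_left_translate[OF assms(1)])

lemma integral_inv:
  assumes "(f :: 'a \<Rightarrow> real) \<in> borel_measurable M"
  shows "(\<integral>x. f (inv x) \<partial>M) = (\<integral>x. f x \<partial>M)"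
  using integral_distr[OF measurable_inv assms] by (simp add: distr_inv)

end

section \<open>Continuity of translation in measure\<close>

text \<open>
  Dominated convergence yields statements about sequences; this lemma and the next one turn them
  into statements about neighbourhoods.
\<close>

lemma first_countable_eventually_imp_nhd:
  assumes X: "first_countable X" and x: "x \<in> topspace X"
    and ev: "\<And>s. (\<And>n. s n \<in> topspace X) \<Longrightarrow> limitin X s x sequentially
               \<Longrightarrow> eventually (\<lambda>n. P (s n)) sequentially"
  shows "\<exists>U. openin X U \<and> x \<in> U \<and> (\<forall>z\<in>U. P z)"
proof (rule ccontr)
  assume neg: "\<not> ?thesis"
  obtain \<B> where \<B>: "countable \<B>" "\<forall>V\<in>\<B>. openin X V"
    and base: "\<forall>U. openin X U \<and> x \<in> U \<longrightarrow> (\<exists>V\<in>\<B>. x \<in> V \<and> V \<subseteq> U)"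
    using X x unfolding first_countable_def by meson
  define \<C> where "\<C> = {V \<in> \<B>. x \<in> V}"
  have "\<C> \<noteq> {}"
    unfolding \<C>_def using base[rule_format, of "topspace X"] x by auto
  moreover have "countable \<C>"
    unfolding \<C>_def using \<B>(1) by simp
  ultimately have range: "range (from_nat_into \<C>) = \<C>"
    by (rule range_from_nat_into)
  define W where "W n = (\<Inter>i\<le>n. from_nat_into \<C> i)" for n
  have mem: "from_nat_into \<C> i \<in> \<C>" for i
    using range by blast
  have "openin X (W n)" for n
    unfolding W_def using mem \<B>(2) by (intro openin_INT2) (auto simp: \<C>_def)
  moreover have "x \<in> W n" for n
    unfolding W_def using mem by (auto simp: \<C>_def)
  ultimately have "\<exists>z. z \<in> W n \<and> \<not> P z" for n
    using neg by blast
  then obtain s where s: "\<And>n. s n \<in> W n" "\<And>n. \<not> P (s n)"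
    by metis
  have "s n \<in> topspace X" for n
    using s(1) \<open>\<And>n. openin X (W n)\<close> openin_subset by blast
  moreover have "limitin X s x sequentially"
    unfolding limitin_def
  proof (intro conjI allI impI x)
    fix U assume U: "openin X U \<and> x \<in> U"
    then obtain V where "V \<in> \<C>" "V \<subseteq> U"
      using base unfolding \<C>_def by blast
    then obtain i where i: "from_nat_into \<C> i \<subseteq> U"
      using range by (metis imageE)
    have "s n \<in> U" if "n \<ge> i" for n
      using s(1)[of n] that i unfolding W_def by blast
    then show "eventually (\<lambda>n. s n \<in> U) sequentially"
      unfolding eventually_sequentially by blast
  qed
  ultimately have "eventually (\<lambda>n. P (s n)) sequentially"
    by (rule ev)
  then show False using s(2) by simp
qed

lemma sequentially_continuous_imp_continuous_map:
  fixes f :: "'a \<Rightarrow> 'b::metric_space"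
  assumes X: "first_countable X"
    and f: "\<And>x s. x \<in> topspace X \<Longrightarrow> (\<And>n. s n \<in> topspace X) \<Longrightarrow> limitin X s x sequentially
              \<Longrightarrow> (\<lambda>n. f (s n)) \<longlonglongrightarrow> f x"
  shows "continuous_map X euclidean f"
  unfolding continuous_map_def
proof (intro conjI allI impI)
  fix U :: "'b set" assume "openin euclidean U"
  then have U: "open U" by simp
  show "openin X {x \<in> topspace X. f x \<in> U}"
  proof (subst openin_subopen, intro ballI)
    fix x assume "x \<in> {x \<in> topspace X. f x \<in> U}"
    then have x: "x \<in> topspace X" "f x \<in> U" by auto
    have "\<exists>W. openin X W \<and> x \<in> W \<and> (\<forall>z\<in>W. f z \<in> U)"
    proof (rule first_countable_eventually_imp_nhd[OF X x(1)])
      fix s assume "\<And>n. s n \<in> topspace X" "limitin X s x sequentially"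
      from f[OF x(1) this] show "eventually (\<lambda>n. f (s n) \<in> U) sequentially"
        using U x(2) by (rule topological_tendstoD)
    qed
    then obtain W where W: "openin X W" "x \<in> W" "\<And>z. z \<in> W \<Longrightarrow> f z \<in> U" by blast
    then have "W \<subseteq> {x \<in> topspace X. f x \<in> U}"
      using openin_subset[OF W(1)] by blast
    with W show "\<exists>W. openin X W \<and> x \<in> W \<and> W \<subseteq> {x \<in> topspace X. f x \<in> U}" by blast
  qed
qed simp

context haar_group
begin

lemma continuous_mult_comp:
  "continuous_map X T f \<Longrightarrow> continuous_map X T g \<Longrightarrow> continuous_map X T (\<lambda>z. f z \<otimes> g z)"
  using continuous_map_compose[OF continuous_map_pairedI continuous_mult, of X f g]
  by (simp add: o_def)

lemma continuous_right_translate: "g \<in> carrier G \<Longrightarrow> continuous_map T T (\<lambda>x. x \<otimes> g)"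
  by (intro continuous_mult_comp) (simp_all add: topspace_eq)

lemma continuous_left_translate: "g \<in> carrier G \<Longrightarrow> continuous_map T T (\<lambda>x. g \<otimes> x)"
  by (intro continuous_mult_comp) (simp_all add: topspace_eq)

lemma bounded_measurable_indicator_translate:
  "A \<in> sets M \<Longrightarrow> g \<in> carrier G \<Longrightarrow> bounded_measurable M (\<lambda>x. indicat_real A (g \<otimes> x))"
  by (rule bounded_measurable_compose[OF bounded_measurable_indicator measurable_left_translate])

lemma integral_indicator_translate:
  "A \<in> sets M \<Longrightarrow> g \<in> carrier G \<Longrightarrow> (\<integral>x. indicat_real A (g \<otimes> x) \<partial>M) = measure M A"
  using integral_left_translate[of g "indicat_real A"] sets.sets_into_space[of A M]
  by (simp add: Int_absorb1)

text \<open>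
  The measure of the symmetric difference of \<open>g\<^sup>-\<^sup>1 A\<close> and \<open>h\<^sup>-\<^sup>1 A\<close>.
\<close>

definition translate_dist :: "'a set \<Rightarrow> 'a \<Rightarrow> 'a \<Rightarrow> real" where
  "translate_dist A g h = (\<integral>x. \<bar>indicat_real A (g \<otimes> x) - indicat_real A (h \<otimes> x)\<bar> \<partial>M)"

lemma integrable_translate_dist:
  assumes "A \<in> sets M" "g \<in> carrier G" "h \<in> carrier G"
  shows "integrable M (\<lambda>x. \<bar>indicat_real A (g \<otimes> x) - indicat_real A (h \<otimes> x)\<bar>)"
  using assms
  by (intro bounded_measurable_integrable bounded_measurable_abs bounded_measurable_diff
      bounded_measurable_indicator_translate)

lemma translate_dist_nonneg: "translate_dist A g h \<ge> 0"
  by (simp add: translate_dist_def)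

lemma translate_dist_Un:
  assumes "A \<in> sets M" "B \<in> sets M" "g \<in> carrier G" "h \<in> carrier G"
  shows "translate_dist (A \<union> B) g h \<le> translate_dist A g h + translate_dist B g h"
proof -
  have "translate_dist (A \<union> B) g h
      \<le> (\<integral>x. \<bar>indicat_real A (g \<otimes> x) - indicat_real A (h \<otimes> x)\<bar>
            + \<bar>indicat_real B (g \<otimes> x) - indicat_real B (h \<otimes> x)\<bar> \<partial>M)"
    unfolding translate_dist_def
    by (intro integral_mono Bochner_Integration.integrable_add integrable_translate_dist
        sets.Un assms) (auto simp: indicator_def)
  also have "\<dots> = translate_dist A g h + translate_dist B g h"
    unfolding translate_dist_def
    by (intro Bochner_Integration.integral_add integrable_translate_dist assms)
  finally show ?thesis .
qed

lemma translate_dist_approx: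
  assumes "A \<in> sets M" "B \<in> sets M" "B \<subseteq> A" "g \<in> carrier G" "h \<in> carrier G"
  shows "translate_dist A g h \<le> translate_dist B g h + 2 * measure M (A - B)"
proof -
  have AB: "A - B \<in> sets M" using assms by blast
  note int = bounded_measurable_integrable[OF bounded_measurable_indicator_translate[OF AB]]
  have "translate_dist (A - B) g h
      \<le> (\<integral>x. indicat_real (A - B) (g \<otimes> x) + indicat_real (A - B) (h \<otimes> x) \<partial>M)"
    unfolding translate_dist_def
    by (intro integral_mono Bochner_Integration.integrable_add integrable_translate_dist
        int AB assms) (auto simp: indicator_def)
  also have "\<dots> = 2 * measure M (A - B)"
    using int assms AB by (subst Bochner_Integration.integral_add) (simp_all add: integral_indicator_translate)
  finally have "translate_dist (A - B) g h \<le> 2 * measure M (A - B)" .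
  moreover have "B \<union> (A - B) = A" using assms(3) by blast
  ultimately show ?thesis
    using translate_dist_Un[OF assms(2) AB assms(4,5)] by simp
qed

lemma translate_dist_Compl:
  assumes "g \<in> carrier G" "h \<in> carrier G"
  shows "translate_dist (carrier G - A) g h = translate_dist A g h"
  unfolding translate_dist_def
  by (rule Bochner_Integration.integral_cong) (use assms in \<open>auto simp: space_M indicator_def\<close>)

text \<open>
  For an open set no point of \<open>g\<^sup>-\<^sup>1 U\<close> escapes from \<open>(s n)\<^sup>-\<^sup>1 U\<close> in the limit, so that the measure of
  \<open>g\<^sup>-\<^sup>1 U - (s n)\<^sup>-\<^sup>1 U\<close> tends to \<open>0\<close>. Both sets have measure \<open>\<mu>(U)\<close>, hence the opposite difference
  has the same measure.
\<close>

lemma translate_dist_tendsto_open: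
  assumes U: "openin T U" and s: "\<And>n. s n \<in> carrier G" and lim: "limitin T s g sequentially"
  shows "(\<lambda>n. translate_dist U (s n) g) \<longlonglongrightarrow> 0"
proof -
  have g: "g \<in> carrier G"
    using lim by (simp add: limitin_def topspace_eq)
  have UM: "U \<in> sets M" using U by (rule open_in_sets)
  note ind = bounded_measurable_indicator_translate[OF UM]
  let ?a = "\<lambda>x. indicat_real U (g \<otimes> x)" and ?b = "\<lambda>n x. indicat_real U (s n \<otimes> x)"
  have bm: "bounded_measurable M (\<lambda>x. ?a x * (1 - ?b n x))" for n
    by (intro bounded_measurable_intros ind g s)
  have "(\<lambda>n. \<integral>x. ?a x * (1 - ?b n x) \<partial>M) \<longlonglongrightarrow> (\<integral>x. 0 \<partial>M)"
  proof (rule bounded_convergence(2)[where C = 1, OF bm])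
    show "(\<lambda>n. ?a x * (1 - ?b n x)) \<longlonglongrightarrow> 0" if "x \<in> space M" for x
    proof -
      from that have x: "x \<in> carrier G" by (simp add: space_M)
      show "(\<lambda>n. ?a x * (1 - ?b n x)) \<longlonglongrightarrow> 0"
      proof (cases "g \<otimes> x \<in> U")
        case True
        have "openin T {z \<in> topspace T. z \<otimes> x \<in> U}"
          using continuous_right_translate[OF x] U by (simp add: continuous_map_def)
        moreover have "g \<in> {z \<in> topspace T. z \<otimes> x \<in> U}"
          using True g by (simp add: topspace_eq)
        ultimately have "eventually (\<lambda>n. s n \<in> {z \<in> topspace T. z \<otimes> x \<in> U}) sequentially"
          using lim unfolding limitin_def by blast
        then have "eventually (\<lambda>n. ?a x * (1 - ?b n x) = 0) sequentially"
          by (rule eventually_mono) simp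
        then show ?thesis by (rule tendsto_eventually)
      qed simp
    qed
    show "\<bar>?a x * (1 - ?b n x)\<bar> \<le> 1" for n x
      by (auto simp: indicator_def)
  qed
  then have lim0: "(\<lambda>n. 2 * (\<integral>x. ?a x * (1 - ?b n x) \<partial>M)) \<longlonglongrightarrow> 0"
    unfolding integral_zero by (rule tendsto_mult_right_zero)
  have "translate_dist U (s n) g = 2 * (\<integral>x. ?a x * (1 - ?b n x) \<partial>M)" for n
  proof -
    have "translate_dist U (s n) g = (\<integral>x. (?b n x - ?a x) + 2 * (?a x * (1 - ?b n x)) \<partial>M)"
      unfolding translate_dist_def
      by (rule Bochner_Integration.integral_cong) (auto simp: indicator_def)
    also have "\<dots> = (\<integral>x. ?b n x - ?a x \<partial>M) + (\<integral>x. 2 * (?a x * (1 - ?b n x)) \<partial>M)"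
      by (intro Bochner_Integration.integral_add bounded_measurable_integrable
          bounded_measurable_cmult bm bounded_measurable_diff ind g s)
    also have "(\<integral>x. ?b n x - ?a x \<partial>M) = (\<integral>x. ?b n x \<partial>M) - (\<integral>x. ?a x \<partial>M)"
      by (intro Bochner_Integration.integral_diff bounded_measurable_integrable ind g s)
    also have "\<dots> = 0"
      using UM s g by (simp add: integral_indicator_translate)
    finally show ?thesis by simp
  qed
  then show ?thesis using lim0 by simp
qed

text \<open>
  The sets \<open>A\<close> with this property form a Dynkin system: in a disjoint union all but finitely many
  of the sets have small total measure, and by invariance they contribute at most twice that measure.
\<close>

lemma translate_dist_tendsto:
  assumes A: "A \<in> sets M" and s: "\<And>n. s n \<in> carrier G" and lim: "limitin T s g sequentially"
  shows "(\<lambda>n. translate_dist A (s n) g) \<longlonglongrightarrow> 0"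
proof -
  have g: "g \<in> carrier G"
    using lim by (simp add: limitin_def topspace_eq)
  have stable: "Int_stable {U. openin T U}"
    by (auto simp: Int_stable_def)
  have sub: "{U. openin T U} \<subseteq> Pow (carrier G)"
    using openin_subset_carrier by blast
  have "A \<in> sigma_sets (carrier G) {U. openin T U}"
    using A by (simp add: sets_M)
  with stable sub show ?thesis
  proof (induction rule: sigma_sets_induct_disjoint)
    case (basic U)
    then show ?case using translate_dist_tendsto_open s lim by simp
  next
    case empty
    show ?case by (simp add: translate_dist_def)
  next
    case (compl A)
    then show ?case using s g by (simp add: translate_dist_Compl)
  next
    case (union A)
    have AM: "A i \<in> sets M" for i
      using union.hyps(2) by (auto simp: sets_M)
    define B where "B N = (\<Union>i<N. A i)" for N
    have BM: "B N \<in> sets M" for N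
      unfolding B_def using AM by auto
    have UM: "(\<Union>i. A i) \<in> sets M"
      using AM by auto
    have B: "(\<lambda>n. translate_dist (B N) (s n) g) \<longlonglongrightarrow> 0" for N
    proof (induction N)
      case 0
      show ?case by (simp add: translate_dist_def B_def)
    next
      case (Suc N)
      have "B (Suc N) = B N \<union> A N"
        by (auto simp: B_def less_Suc_eq)
      then have le: "translate_dist (B (Suc N)) (s n) g
          \<le> translate_dist (B N) (s n) g + translate_dist (A N) (s n) g" for n
        using translate_dist_Un[OF BM AM s g] by simp
      have "(\<lambda>n. translate_dist (B N) (s n) g + translate_dist (A N) (s n) g) \<longlonglongrightarrow> 0"
        using tendsto_add[OF Suc union.IH[of N]] by simp
      then show ?case
        by (rule tendsto_sandwich[OF always_eventually always_eventually tendsto_const, rotated 2])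
          (use le translate_dist_nonneg in blast)+
    qed
    have UB: "(\<Union>N. B N) = (\<Union>i. A i)"
      unfolding B_def by auto
    have "incseq B"
      unfolding B_def incseq_def by (auto intro: order_less_le_trans)
    then have "(\<lambda>N. measure M (B N)) \<longlonglongrightarrow> measure M (\<Union>i. A i)"
      using finite_Lim_measure_incseq[of B] BM unfolding UB by auto
    show ?case
    proof (rule LIMSEQ_I)
      fix e :: real assume e: "e > 0"
      obtain N where N: "\<bar>measure M (B N) - measure M (\<Union>i. A i)\<bar> < e / 4"
        using LIMSEQ_D[OF \<open>(\<lambda>N. measure M (B N)) \<longlonglongrightarrow> _\<close>, of "e / 4"] e by auto
      have "B N \<subseteq> (\<Union>i. A i)" unfolding B_def by auto
      then have "measure M ((\<Union>i. A i) - B N) < e / 4"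
        using finite_measure_Diff[OF UM BM \<open>B N \<subseteq> _\<close>] N by linarith
      moreover have "eventually (\<lambda>n. translate_dist (B N) (s n) g < e / 2) sequentially"
        by (rule order_tendstoD(2)[OF B]) (use e in simp)
      then obtain n0 where n0: "\<And>n. n \<ge> n0 \<Longrightarrow> translate_dist (B N) (s n) g < e / 2"
        unfolding eventually_sequentially by blast
      ultimately have "translate_dist (\<Union>i. A i) (s n) g < e" if "n \<ge> n0" for n
        using translate_dist_approx[OF UM BM \<open>B N \<subseteq> _\<close> s g, of n] n0[OF that] by linarith
      then show "\<exists>n0. \<forall>n\<ge>n0. norm (translate_dist (\<Union>i. A i) (s n) g - 0) < e"
        unfolding real_norm_def diff_zero abs_of_nonneg[OF translate_dist_nonneg] by blast
    qed
  qed
qed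

lemma translate_dist_nhd:
  assumes A: "A \<in> sets M" and g: "g \<in> carrier G" and e: "e > 0"
  shows "\<exists>U. openin T U \<and> g \<in> U \<and> (\<forall>h\<in>U. translate_dist A h g < e)"
proof (rule first_countable_eventually_imp_nhd)
  show "first_countable T"
    using second_countable by (rule second_countable_imp_first_countable)
  show "g \<in> topspace T" using g by (simp add: topspace_eq)
  fix s assume "\<And>n. s n \<in> topspace T" "limitin T s g sequentially"
  then have "(\<lambda>n. translate_dist A (s n) g) \<longlonglongrightarrow> 0"
    using translate_dist_tendsto[OF A] by (simp add: topspace_eq)
  then show "eventually (\<lambda>n. translate_dist A (s n) g < e) sequentially"
    using e by (rule order_tendstoD(2))
qed

end

section \<open>Convolution with an indicator function\<close>

context haar_group
begin

abbreviation conv :: "'a set \<Rightarrow> ('a \<Rightarrow> real) \<Rightarrow> 'a \<Rightarrow> real" where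
  "conv A \<equiv> convolution G M (indicat_real A)"

lemma mem_set_inv_iff:
  assumes "A \<in> sets M" "x \<in> carrier G"
  shows "x \<in> set_inv A \<longleftrightarrow> inv x \<in> A"
proof
  have AG: "A \<subseteq> carrier G" using sets.sets_into_space[OF assms(1)] by (simp add: space_M)
  show "inv x \<in> A" if "x \<in> set_inv A"
    using that AG by (auto simp: SET_INV_def)
  show "x \<in> set_inv A" if "inv x \<in> A"
    using that assms(2) unfolding SET_INV_def by (intro UN_I[of "inv x"]) simp_all
qed

lemma set_inv_eq_vimage:
  assumes "A \<in> sets M"
  shows "set_inv A = (\<lambda>x. inv x) -` A \<inter> space M"
proof -
  have "set_inv A \<subseteq> carrier G"
    using sets.sets_into_space[OF assms] by (auto simp: SET_INV_def space_M)
  then show ?thesis using mem_set_inv_iff[OF assms] by (auto simp: space_M)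
qed

lemma sets_set_inv: "A \<in> sets M \<Longrightarrow> set_inv A \<in> sets M"
  by (simp add: set_inv_eq_vimage measurable_sets[OF measurable_inv])

lemma measure_set_inv: "A \<in> sets M \<Longrightarrow> measure M (set_inv A) = measure M A"
  using measure_distr[OF measurable_inv, of A] by (simp add: distr_inv set_inv_eq_vimage)

lemma measurable_div_right: "x \<in> carrier G \<Longrightarrow> (\<lambda>y. x \<otimes> inv y) \<in> measurable M M"
  by (rule measurable_compose[OF measurable_inv measurable_left_translate])

lemma bounded_measurable_kernel:
  "A \<in> sets M \<Longrightarrow> x \<in> carrier G \<Longrightarrow> bounded_measurable M (\<lambda>y. indicat_real A (x \<otimes> inv y))"
  by (rule bounded_measurable_compose[OF bounded_measurable_indicator measurable_div_right])

lemma conv_eq_inner: "conv A f x = inner_L2 M (\<lambda>y. indicat_real A (x \<otimes> inv y)) f"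
  by (simp add: convolution_def inner_L2_def)

lemma integral_kernel:
  assumes "A \<in> sets M" "x \<in> carrier G"
  shows "(\<integral>y. indicat_real A (x \<otimes> inv y) \<partial>M) = measure M A"
proof -
  have "(\<integral>y. indicat_real A (x \<otimes> inv y) \<partial>M) = (\<integral>y. indicat_real A (x \<otimes> y) \<partial>M)"
    by (rule integral_inv[OF bounded_measurable_measurable])
      (rule bounded_measurable_indicator_translate[OF assms])
  then show ?thesis using integral_indicator_translate[OF assms] by simp
qed

lemma inner_kernel_self:
  assumes "A \<in> sets M" "x \<in> carrier G"
  shows "inner_L2 M (\<lambda>y. indicat_real A (x \<otimes> inv y)) (\<lambda>y. indicat_real A (x \<otimes> inv y)) = measure M A"
  unfolding inner_L2_def integral_kernel[OF assms, symmetric]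
  by (rule Bochner_Integration.integral_cong) (auto simp: indicator_def)

text \<open>
  The Cauchy-Schwarz inequality; the row of the kernel at \<open>x\<close> has squared norm \<open>\<mu>(A)\<close> for every \<open>x\<close>.
\<close>

lemma conv_bound:
  assumes "A \<in> sets M" "bounded_measurable M f" "x \<in> carrier G"
  shows "(conv A f x)\<^sup>2 \<le> measure M A * inner_L2 M f f"
  using inner_L2_Cauchy_Schwarz[OF bounded_measurable_kernel[OF assms(1,3)] assms(2)]
  by (simp add: conv_eq_inner inner_kernel_self[OF assms(1,3)])

lemma conv_square_le:
  assumes "A \<in> sets M" "bounded_measurable M f" "x \<in> carrier G"
  shows "(conv A f x)\<^sup>2 \<le> inner_L2 M f f"
proof -
  have "measure M A \<le> 1"
    using finite_measure_mono[of A "carrier G"] sets.sets_into_space[OF assms(1)] sets.top[of M]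
    by (simp add: space_M measure_M)
  then have "measure M A * inner_L2 M f f \<le> 1 * inner_L2 M f f"
    using inner_L2_self_nonneg by (rule mult_right_mono)
  then show ?thesis using conv_bound[OF assms] by linarith
qed

lemma conv_bound_norm:
  assumes "A \<in> sets M" "bounded_measurable M f" "x \<in> carrier G"
  shows "\<bar>conv A f x\<bar> \<le> sqrt (inner_L2 M f f)"
  by (rule real_le_rsqrt) (simp add: conv_square_le[OF assms])

lemma kernel_measurable_pair:
  assumes "A \<in> sets M"
  shows "(\<lambda>(x, y). indicat_real A (x \<otimes> inv y)) \<in> borel_measurable (M \<Otimes>\<^sub>M M)"
proof -
  have "(\<lambda>p. fst p \<otimes> inv (snd p)) \<in> measurable (M \<Otimes>\<^sub>M M) M"
    by (intro measurable_mult_comp measurable_fst measurable_compose[OF measurable_snd measurable_inv])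
  from measurable_compose[OF this bounded_measurable_measurable[OF bounded_measurable_indicator[OF assms]]]
  show ?thesis by (simp add: case_prod_beta')
qed

lemma conv_bounded_measurable:
  assumes "A \<in> sets M" "bounded_measurable M f"
  shows "bounded_measurable M (conv A f)"
proof (rule bounded_measurableI)
  have "(\<lambda>(x, y). indicat_real A (x \<otimes> inv y) * f y) \<in> borel_measurable (M \<Otimes>\<^sub>M M)"
    using borel_measurable_times[OF kernel_measurable_pair[OF assms(1)]
        measurable_compose[OF measurable_snd bounded_measurable_measurable[OF assms(2)]]]
    by (simp add: case_prod_beta')
  then show "conv A f \<in> borel_measurable M"
    unfolding convolution_def by (rule borel_measurable_lebesgue_integral)
  show "\<bar>conv A f x\<bar> \<le> sqrt (inner_L2 M f f)" if "x \<in> space M" for x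
    using conv_bound_norm[OF assms] that by (simp add: space_M)
qed

text \<open>Exchanging the order of integration, because \<open>x y\<^sup>-\<^sup>1 \<in> A\<close> iff \<open>y x\<^sup>-\<^sup>1 \<in> A\<^sup>-\<^sup>1\<close>.\<close>

lemma conv_adjoint:
  assumes A: "A \<in> sets M" and f: "bounded_measurable M f" and u: "bounded_measurable M u"
  shows "inner_L2 M (conv A f) u = inner_L2 M f (conv (set_inv A) u)"
proof -
  interpret P: finite_measure "M \<Otimes>\<^sub>M M"
    by (rule finite_measure_pair_measure) unfold_locales
  obtain C where C: "C \<ge> 0" "\<And>x. x \<in> space M \<Longrightarrow> \<bar>f x\<bar> \<le> C"
    using f by (rule bounded_measurableE) blast
  obtain D where D: "D \<ge> 0" "\<And>x. x \<in> space M \<Longrightarrow> \<bar>u x\<bar> \<le> D"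
    using u by (rule bounded_measurableE) blast
  define F where "F x y = indicat_real A (x \<otimes> inv y) * (f y * u x)" for x y
  have meas: "case_prod F \<in> borel_measurable (M \<Otimes>\<^sub>M M)"
    unfolding F_def
    using borel_measurable_times[OF kernel_measurable_pair[OF A]
        borel_measurable_times[OF
          measurable_compose[OF measurable_snd bounded_measurable_measurable[OF f]]
          measurable_compose[OF measurable_fst bounded_measurable_measurable[OF u]]]]
    by (simp add: case_prod_beta')
  have "\<bar>F x y\<bar> \<le> C * D" if "x \<in> space M" "y \<in> space M" for x y
  proof -
    have "\<bar>F x y\<bar> \<le> \<bar>f y\<bar> * \<bar>u x\<bar>"
      by (simp add: F_def abs_mult indicator_def)
    also have "\<dots> \<le> C * D"
      using C D that by (intro mult_mono) auto
    finally show ?thesis .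
  qed
  then have int: "integrable (M \<Otimes>\<^sub>M M) (case_prod F)"
    using meas by (intro P.integrable_const_bound[where B = "C * D"] AE_I2)
      (auto simp: space_pair_measure)
  have "inner_L2 M (conv A f) u = (\<integral>x. (\<integral>y. F x y \<partial>M) \<partial>M)"
    unfolding inner_L2_def convolution_def F_def
    by (simp flip: integral_mult_left_zero add: mult.assoc)
  also have "\<dots> = (\<integral>y. (\<integral>x. F x y \<partial>M) \<partial>M)"
    using pair.Fubini_integral[OF int] by simp
  also have "\<dots> = (\<integral>y. f y * conv (set_inv A) u y \<partial>M)"
  proof (rule Bochner_Integration.integral_cong[OF refl])
    fix y assume y: "y \<in> space M"
    have "F x y = f y * (indicat_real (set_inv A) (y \<otimes> inv x) * u x)" if "x \<in> space M" for x
      using that y by (simp add: F_def mem_set_inv_iff[OF A] space_M indicator_def inv_mult_group)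
    then have "(\<integral>x. F x y \<partial>M) = (\<integral>x. f y * (indicat_real (set_inv A) (y \<otimes> inv x) * u x) \<partial>M)"
      by (rule Bochner_Integration.integral_cong[OF refl])
    then show "(\<integral>x. F x y \<partial>M) = f y * conv (set_inv A) u y"
      by (simp add: convolution_def)
  qed
  finally show ?thesis by (simp add: inner_L2_def)
qed

lemma conv_const:
  "A \<in> sets M \<Longrightarrow> x \<in> carrier G \<Longrightarrow> conv A (\<lambda>_. c) x = c * measure M A"
  using integral_kernel by (simp add: convolution_def mult.commute)

lemma conv_diff:
  assumes "A \<in> sets M" "bounded_measurable M f" "bounded_measurable M g" "x \<in> carrier G"
  shows "conv A (\<lambda>y. f y - g y) x = conv A f x - conv A g x"
  using inner_L2_diff[OF assms(2,3) bounded_measurable_kernel[OF assms(1,4)]]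
  by (simp add: conv_eq_inner inner_L2_commute)

lemma conv_cmult: "conv A (\<lambda>y. c * f y) x = c * conv A f x"
  by (simp add: conv_eq_inner inner_L2_commute[of M "\<lambda>y. indicat_real A (x \<otimes> inv y)"] inner_L2_cmult)

lemma conv_cong:
  "(\<And>y. y \<in> carrier G \<Longrightarrow> f y = g y) \<Longrightarrow> conv A f x = conv A g x"
  unfolding conv_eq_inner by (rule inner_L2_cong) (auto simp: space_M)

lemma integral_conv:
  assumes "A \<in> sets M" "bounded_measurable M f"
  shows "(\<integral>x. conv A f x \<partial>M) = measure M A * (\<integral>x. f x \<partial>M)"
proof -
  have "(\<integral>x. conv A f x \<partial>M) = inner_L2 M (conv A f) (\<lambda>_. 1)"
    by (simp add: inner_L2_def)
  also have "\<dots> = inner_L2 M f (conv (set_inv A) (\<lambda>_. 1))"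
    by (rule conv_adjoint[OF assms bounded_measurable_const])
  also have "\<dots> = inner_L2 M f (\<lambda>_. measure M A)"
    using assms by (intro inner_L2_cong)
      (simp_all add: space_M conv_const sets_set_inv measure_set_inv)
  also have "\<dots> = measure M A * (\<integral>x. f x \<partial>M)"
    by (simp add: inner_L2_def mult.commute)
  finally show ?thesis .
qed

text \<open>The reason why eigenspaces of left convolutions are invariant under right translation.\<close>

lemma conv_right_translate:
  assumes A: "A \<in> sets M" and f: "bounded_measurable M f" and g: "g \<in> carrier G" and x: "x \<in> carrier G"
  shows "conv A (\<lambda>y. f (y \<otimes> g)) x = conv A f (x \<otimes> g)"
proof -
  let ?h = "\<lambda>z. indicat_real A (x \<otimes> g \<otimes> inv z) * f z"
  have "?h \<in> borel_measurable M"
    using x g by (intro bounded_measurable_measurable bounded_measurable_mult f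
        bounded_measurable_kernel A) simp
  then have "(\<integral>y. ?h (y \<otimes> g) \<partial>M) = conv A f (x \<otimes> g)"
    unfolding convolution_def by (rule integral_right_translate[OF g])
  moreover have "?h (y \<otimes> g) = indicat_real A (x \<otimes> inv y) * f (y \<otimes> g)" if "y \<in> carrier G" for y
  proof -
    have "g \<otimes> (inv g \<otimes> inv y) = inv y"
      using g that by (simp flip: m_assoc)
    then have "x \<otimes> g \<otimes> inv (y \<otimes> g) = x \<otimes> inv y"
      using x g that by (simp add: inv_mult_group m_assoc)
    then show ?thesis using x g that by simp
  qed
  then have "(\<integral>y. ?h (y \<otimes> g) \<partial>M) = conv A (\<lambda>y. f (y \<otimes> g)) x"
    unfolding convolution_def by (intro Bochner_Integration.integral_cong) (auto simp: space_M)
  ultimately show ?thesis by simp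
qed

text \<open>
  The modulus of continuity of \<open>1\<^sub>A \<star> f\<close> depends only on \<open>A\<close> and on a bound for \<open>f\<close>: bounded
  families of functions are mapped to equicontinuous ones.
\<close>

lemma conv_equicontinuous:
  assumes A: "A \<in> sets M" and f: "bounded_measurable M f"
    and C: "\<And>y. y \<in> carrier G \<Longrightarrow> \<bar>f y\<bar> \<le> C"
    and x: "x \<in> carrier G" and z: "z \<in> carrier G"
  shows "\<bar>conv A f x - conv A f z\<bar> \<le> C * translate_dist A x z"
proof -
  let ?k = "\<lambda>x y. indicat_real A (x \<otimes> inv y)"
  let ?d = "\<lambda>y. \<bar>indicat_real A (x \<otimes> y) - indicat_real A (z \<otimes> y)\<bar>"
  have d: "bounded_measurable M ?d"
    by (intro bounded_measurable_abs bounded_measurable_diff bounded_measurable_indicator_translate A x z)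
  have k: "bounded_measurable M (\<lambda>y. ?k x y - ?k z y)"
    by (intro bounded_measurable_diff bounded_measurable_kernel A x z)
  have "conv A f x - conv A f z = (\<integral>y. (?k x y - ?k z y) * f y \<partial>M)"
    using inner_L2_diff[OF bounded_measurable_kernel[OF A x] bounded_measurable_kernel[OF A z] f]
    by (simp add: conv_eq_inner inner_L2_def)
  then have "\<bar>conv A f x - conv A f z\<bar> \<le> (\<integral>y. \<bar>(?k x y - ?k z y) * f y\<bar> \<partial>M)"
    by (simp add: integral_abs_bound)
  also have "\<dots> \<le> (\<integral>y. C * ?d (inv y) \<partial>M)"
  proof (rule integral_mono)
    show "integrable M (\<lambda>y. \<bar>(?k x y - ?k z y) * f y\<bar>)"
      by (intro bounded_measurable_integrable bounded_measurable_abs bounded_measurable_mult k f)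
    show "integrable M (\<lambda>y. C * ?d (inv y))"
      by (intro bounded_measurable_integrable bounded_measurable_cmult
          bounded_measurable_compose[OF d measurable_inv])
    show "\<bar>(?k x y - ?k z y) * f y\<bar> \<le> C * ?d (inv y)" if "y \<in> space M" for y
      using C[of y] that by (simp add: abs_mult space_M mult.commute[of C] mult_left_mono)
  qed
  also have "\<dots> = C * translate_dist A x z"
    using integral_inv[OF bounded_measurable_measurable[OF d]] by (simp add: translate_dist_def)
  finally show ?thesis .
qed

lemma conv_tendsto:
  assumes A: "A \<in> sets M" and x: "x \<in> carrier G"
    and f: "\<And>n. bounded_measurable M (f n)"
    and C: "\<And>n y. y \<in> carrier G \<Longrightarrow> \<bar>f n y\<bar> \<le> C"
    and lim: "\<And>y. y \<in> carrier G \<Longrightarrow> (\<lambda>n. f n y) \<longlonglongrightarrow> h y"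
  shows "(\<lambda>n. conv A (f n) x) \<longlonglongrightarrow> conv A h x"
  unfolding convolution_def
proof (rule bounded_convergence(2)[where C = C])
  show "bounded_measurable M (\<lambda>y. indicat_real A (x \<otimes> inv y) * f n y)" for n
    by (intro bounded_measurable_mult bounded_measurable_kernel A x f)
  fix y assume "y \<in> space M"
  then have y: "y \<in> carrier G" by (simp add: space_M)
  show "(\<lambda>n. indicat_real A (x \<otimes> inv y) * f n y) \<longlonglongrightarrow> indicat_real A (x \<otimes> inv y) * h y"
    by (intro tendsto_mult tendsto_const lim y)
  show "\<bar>indicat_real A (x \<otimes> inv y) * f n y\<bar> \<le> C" for n
    using C[OF y, of n] by (auto simp: indicator_def)
qed

end

section \<open>The largest eigenvalue\<close>

locale haar_group_set = haar_group +
  fixes A :: "'a set"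
  assumes A: "A \<in> sets M"
begin

abbreviation conv_A :: "('a \<Rightarrow> real) \<Rightarrow> 'a \<Rightarrow> real" where
  "conv_A \<equiv> conv A"

text \<open>
  The adjoint of convolution with \<open>1\<^sub>A\<close> is convolution with the indicator of \<open>A\<^sup>-\<^sup>1\<close>
  (\<open>conv_adjoint\<close>), so this is \<open>T\<^sup>* T\<close> for \<open>T f = 1\<^sub>A * f\<close>.
\<close>

definition gram :: "('a \<Rightarrow> real) \<Rightarrow> 'a \<Rightarrow> real" where
  "gram f = conv (set_inv A) (conv_A f)"

definition mean_zero :: "('a \<Rightarrow> real) \<Rightarrow> bool" where
  "mean_zero f \<longleftrightarrow> bounded_measurable M f \<and> (\<integral>x. f x \<partial>M) = 0"

abbreviation energy :: "('a \<Rightarrow> real) \<Rightarrow> real" where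
  "energy f \<equiv> inner_L2 M (conv_A f) (conv_A f)"

text \<open>
  A supremum of the quadratic form of \<open>gram\<close>; that it is an eigenvalue, when positive, is
  \<open>ex_eigenfunction\<close>.
\<close>

definition top_eigenvalue :: real where
  "top_eigenvalue = Sup (energy ` {f. mean_zero f \<and> inner_L2 M f f \<le> 1})"

lemmas A' = sets_set_inv[OF A]

lemma mean_zero_bounded_measurable: "mean_zero f \<Longrightarrow> bounded_measurable M f"
  by (simp add: mean_zero_def)

lemma gram_bounded_measurable: "bounded_measurable M f \<Longrightarrow> bounded_measurable M (gram f)"
  unfolding gram_def by (intro conv_bounded_measurable A A')

lemma gram_mean_zero:
  assumes "mean_zero f"
  shows "mean_zero (gram f)"
proof -
  have f: "bounded_measurable M f" and f0: "(\<integral>x. f x \<partial>M) = 0"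
    using assms by (simp_all add: mean_zero_def)
  have "(\<integral>x. gram f x \<partial>M) = measure M (set_inv A) * (measure M A * (\<integral>x. f x \<partial>M))"
    unfolding gram_def
    by (simp only: integral_conv[OF A' conv_bounded_measurable[OF A f]] integral_conv[OF A f])
  then show ?thesis
    using gram_bounded_measurable[OF f] f0 by (simp add: mean_zero_def)
qed

lemma gram_adjoint:
  assumes f: "bounded_measurable M f" and g: "bounded_measurable M g"
  shows "inner_L2 M (gram f) g = inner_L2 M (conv_A f) (conv_A g)"
  using conv_adjoint[OF A g conv_bounded_measurable[OF A f]]
  by (simp only: gram_def inner_L2_commute[of M "conv (set_inv A) (conv_A f)" g]
      inner_L2_commute[of M "conv_A f" "conv_A g"])

lemma energy_le:
  assumes f: "bounded_measurable M f"
  shows "energy f \<le> inner_L2 M f f"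
proof -
  have "energy f \<le> (\<integral>x. inner_L2 M f f \<partial>M)"
    unfolding inner_L2_def[of M "conv_A f"]
  proof (rule integral_mono)
    show "integrable M (\<lambda>x. conv_A f x * conv_A f x)"
      by (intro bounded_measurable_integrable bounded_measurable_mult conv_bounded_measurable A f)
    fix x assume x: "x \<in> space M"
    then show "conv_A f x * conv_A f x \<le> inner_L2 M f f"
      using conv_square_le[OF A f, of x] by (simp add: space_M power2_eq_square)
  qed simp
  then show ?thesis by (simp add: space_M measure_M)
qed

lemma energy_bdd_above: "bdd_above (energy ` {f. mean_zero f \<and> inner_L2 M f f \<le> 1})"
  by (rule bdd_aboveI[where M = 1]) (auto simp: mean_zero_def intro: order_trans[OF energy_le])

lemma energy_le_top_eigenvalue: "mean_zero f \<Longrightarrow> inner_L2 M f f \<le> 1 \<Longrightarrow> energy f \<le> top_eigenvalue"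
  unfolding top_eigenvalue_def by (rule cSup_upper[OF _ energy_bdd_above]) simp

lemma mean_zero_cmult: "mean_zero f \<Longrightarrow> mean_zero (\<lambda>x. c * f x)"
  by (simp add: mean_zero_def bounded_measurable_cmult)

lemma energy_cmult: "energy (\<lambda>x. c * f x) = c\<^sup>2 * energy f"
proof -
  have "conv_A (\<lambda>x. c * f x) = (\<lambda>x. c * conv_A f x)"
    by (rule ext) (rule conv_cmult)
  then show ?thesis by (simp add: inner_L2_cmult_both)
qed

lemma top_eigenvalue_nonneg: "top_eigenvalue \<ge> 0"
proof -
  have "mean_zero (\<lambda>_. 0)" by (simp add: mean_zero_def bounded_measurable_const)
  then have "energy (\<lambda>_. 0) \<le> top_eigenvalue" by (rule energy_le_top_eigenvalue) (simp add: inner_L2_def)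
  then show ?thesis by (rule order_trans[OF inner_L2_self_nonneg])
qed

lemma energy_le_top_eigenvalue_mult:
  assumes f: "mean_zero f"
  shows "energy f \<le> top_eigenvalue * inner_L2 M f f"
proof (cases "inner_L2 M f f = 0")
  case True
  then show ?thesis using energy_le[OF mean_zero_bounded_measurable[OF f]] by simp
next
  case False
  define N where "N = inner_L2 M f f"
  have N: "N > 0" using False inner_L2_self_nonneg[of M f] by (simp add: N_def)
  define c where "c = 1 / sqrt N"
  have c: "c\<^sup>2 = 1 / N" using N by (simp add: c_def power_divide)
  have "energy (\<lambda>x. c * f x) \<le> top_eigenvalue"
    using N by (intro energy_le_top_eigenvalue mean_zero_cmult f) (simp add: inner_L2_cmult_both c N_def)
  then show ?thesis using N by (simp add: energy_cmult c N_def field_simps)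
qed

text \<open>
  With \<open>\<lambda>\<close> the largest eigenvalue, this is the inequality \<open>gram\<^sup>2 \<le> \<lambda> gram\<close> of quadratic forms. It
  follows from the Cauchy-Schwarz inequality for \<open>T f\<close> and \<open>T (gram f)\<close>, whose inner product is
  the left-hand side.
\<close>

lemma gram_norm_le:
  assumes f: "mean_zero f"
  shows "inner_L2 M (gram f) (gram f) \<le> top_eigenvalue * energy f"
proof -
  note bf = mean_zero_bounded_measurable[OF f]
  let ?a = "inner_L2 M (gram f) (gram f)"
  have "?a\<^sup>2 = (inner_L2 M (conv_A f) (conv_A (gram f)))\<^sup>2"
    using gram_adjoint[OF bf gram_bounded_measurable[OF bf]] by simp
  also have "\<dots> \<le> energy f * energy (gram f)"
    by (intro inner_L2_Cauchy_Schwarz conv_bounded_measurable A gram_bounded_measurable bf)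
  also have "\<dots> \<le> energy f * (top_eigenvalue * ?a)"
    by (intro mult_left_mono energy_le_top_eigenvalue_mult gram_mean_zero f inner_L2_self_nonneg)
  finally have "?a * ?a \<le> (top_eigenvalue * energy f) * ?a"
    by (simp add: power2_eq_square mult_ac)
  moreover have "0 \<le> top_eigenvalue * energy f"
    by (intro mult_nonneg_nonneg top_eigenvalue_nonneg inner_L2_self_nonneg)
  ultimately show ?thesis
    using inner_L2_self_nonneg[of M "gram f"] by (cases "?a = 0") (auto simp: mult_le_cancel_right)
qed

lemma gram_bound_norm:
  assumes f: "bounded_measurable M f" and x: "x \<in> carrier G"
  shows "\<bar>gram f x\<bar> \<le> sqrt (inner_L2 M f f)"
proof -
  have "\<bar>gram f x\<bar> \<le> sqrt (energy f)"
    unfolding gram_def by (intro conv_bound_norm A' conv_bounded_measurable A f x)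
  also have "\<dots> \<le> sqrt (inner_L2 M f f)"
    by (intro real_sqrt_le_mono energy_le f)
  finally show ?thesis .
qed

lemma gram_diff_cmult:
  assumes "bounded_measurable M f" "bounded_measurable M g" "x \<in> carrier G"
  shows "gram (\<lambda>y. f y - c * g y) x = gram f x - c * gram g x"
proof -
  have "gram (\<lambda>y. f y - c * g y) x = conv (set_inv A) (\<lambda>y. conv_A f y - c * conv_A g y) x"
    unfolding gram_def
    by (rule conv_cong) (simp add: conv_diff[OF A] assms bounded_measurable_cmult conv_cmult)
  also have "\<dots> = gram f x - c * gram g x"
    using assms A A'
    by (simp add: gram_def conv_diff conv_bounded_measurable bounded_measurable_cmult conv_cmult)
  finally show ?thesis .
qed

lemma inner_L2_self_le:
  assumes f: "bounded_measurable M f" and B: "\<And>x. x \<in> carrier G \<Longrightarrow> \<bar>f x\<bar> \<le> B"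
  shows "inner_L2 M f f \<le> B\<^sup>2"
proof -
  have "inner_L2 M f f \<le> (\<integral>x. B\<^sup>2 \<partial>M)"
    unfolding inner_L2_def
  proof (rule integral_mono)
    show "integrable M (\<lambda>x. f x * f x)"
      by (intro bounded_measurable_integrable bounded_measurable_mult f)
    show "f x * f x \<le> B\<^sup>2" if "x \<in> space M" for x
      using power_mono[OF B abs_ge_zero, of x 2] that by (simp add: space_M power2_eq_square)
  qed simp
  then show ?thesis by (simp add: space_M measure_M)
qed

lemma gram_tendsto:
  assumes x: "x \<in> carrier G"
    and f: "\<And>n. bounded_measurable M (f n)"
    and B: "\<And>n y. y \<in> carrier G \<Longrightarrow> \<bar>f n y\<bar> \<le> B"
    and lim: "\<And>y. y \<in> carrier G \<Longrightarrow> (\<lambda>n. f n y) \<longlonglongrightarrow> h y"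
  shows "(\<lambda>n. gram (f n) x) \<longlonglongrightarrow> gram h x"
  unfolding gram_def
proof (rule conv_tendsto[OF A' x])
  show "bounded_measurable M (conv_A (f n))" for n
    by (intro conv_bounded_measurable A f)
  show "(\<lambda>n. conv_A (f n) y) \<longlonglongrightarrow> conv_A h y" if "y \<in> carrier G" for y
    by (rule conv_tendsto[OF A that f B lim])
  show "\<bar>conv_A (f n) y\<bar> \<le> \<bar>B\<bar>" if "y \<in> carrier G" for n y
    using conv_bound_norm[OF A f that, of n] real_sqrt_le_mono[OF inner_L2_self_le[OF f B, of n]]
    by simp
qed

text \<open>
  Compactness of \<open>gram\<close>: a diagonal argument gives convergence on a countable dense set and
  equicontinuity propagates it to all of \<open>G\<close>.
\<close>

lemma gram_convergent_subsequence:
  assumes f: "\<And>n. bounded_measurable M (f n)" and f1: "\<And>n. inner_L2 M (f n) (f n) \<le> 1"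
  obtains k :: "nat \<Rightarrow> nat" where "strict_mono k"
    "\<And>x. x \<in> carrier G \<Longrightarrow> convergent (\<lambda>n. gram (f (k n)) x)"
proof -
  obtain D where D: "countable D" "D \<subseteq> carrier G" "T closure_of D = carrier G"
    using second_countable_imp_separable_space[OF second_countable]
    unfolding separable_space_def topspace_eq by blast
  have "sqrt (inner_L2 M (f n) (f n)) \<le> 1" for n
    using f1 by simp
  then have one: "\<bar>gram (f n) x\<bar> \<le> 1" and one': "\<bar>conv_A (f n) x\<bar> \<le> 1"
    if "x \<in> carrier G" for n x
    using order_trans[OF gram_bound_norm[OF f that]] order_trans[OF conv_bound_norm[OF A f that]]
    by simp_all
  obtain k where k: "strict_mono (k :: nat \<Rightarrow> nat)"
    and conv: "\<And>d. d \<in> D \<Longrightarrow> \<exists>l. (\<lambda>n. gram (f (k n)) d) \<longlonglongrightarrow> l"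
  proof (rule function_convergent_subsequence[of D "\<lambda>n x. gram (f n) x" 1])
    show "norm (gram (f n) x) \<le> 1" if "x \<in> D" for n x
      using one that D(2) by auto
  qed (use D(1) in blast)+
  have "convergent (\<lambda>n. gram (f (k n)) x)" if x: "x \<in> carrier G" for x
  proof (rule Cauchy_convergent, rule metric_CauchyI)
    fix e :: real assume e: "e > 0"
    then have "e / 3 > 0" by simp
    from translate_dist_nhd[OF A' x this]
    obtain U where U: "openin T U" "x \<in> U"
      and close: "\<And>h. h \<in> U \<Longrightarrow> translate_dist (set_inv A) h x < e / 3" by blast
    have "D \<inter> U \<noteq> {}"
      using D(3) U dense_intersects_open[of T D] by (auto simp: topspace_eq)
    then obtain d where d: "d \<in> D" "d \<in> U" by blast
    then have dG: "d \<in> carrier G" using D(2) by blast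
    have near: "\<bar>gram (f n) d - gram (f n) x\<bar> < e / 3" for n
    proof -
      have "\<bar>gram (f n) d - gram (f n) x\<bar> \<le> 1 * translate_dist (set_inv A) d x"
        unfolding gram_def
        by (intro conv_equicontinuous A' conv_bounded_measurable A f one' dG x)
      then show ?thesis using close[OF d(2)] by simp
    qed
    have "Cauchy (\<lambda>n. gram (f (k n)) d)"
      using conv[OF d(1)] by (auto intro: LIMSEQ_imp_Cauchy)
    then obtain N where N: "\<And>m n. m \<ge> N \<Longrightarrow> n \<ge> N \<Longrightarrow> dist (gram (f (k m)) d) (gram (f (k n)) d) < e / 3"
      using \<open>e / 3 > 0\<close> unfolding Cauchy_def by blast
    have "dist (gram (f (k m)) x) (gram (f (k n)) x) < e" if "m \<ge> N" "n \<ge> N" for m n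
      using near[of "k m"] near[of "k n"] N[OF that] unfolding dist_real_def by linarith
    then show "\<exists>N. \<forall>m\<ge>N. \<forall>n\<ge>N. dist (gram (f (k m)) x) (gram (f (k n)) x) < e" by blast
  qed
  with k that show thesis by blast
qed

lemma ex_maximizing_sequence:
  obtains f where "\<And>n. mean_zero (f n)" "\<And>n. inner_L2 M (f n) (f n) \<le> 1"
    "(\<lambda>n. energy (f n)) \<longlonglongrightarrow> top_eigenvalue"
proof -
  let ?V = "{f. mean_zero f \<and> inner_L2 M f f \<le> 1}"
  have "(\<lambda>_. 0) \<in> ?V"
    by (simp add: mean_zero_def bounded_measurable_const inner_L2_def)
  then have ne: "energy ` ?V \<noteq> {}" by blast
  have "\<exists>f. f \<in> ?V \<and> top_eigenvalue - 1 / real (Suc n) < energy f" for n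
  proof -
    have "top_eigenvalue - 1 / real (Suc n) < Sup (energy ` ?V)"
      unfolding top_eigenvalue_def[symmetric] by simp
    from less_cSupD[OF ne this] show ?thesis by blast
  qed
  then have "\<forall>n. \<exists>f. f \<in> ?V \<and> top_eigenvalue - 1 / real (Suc n) < energy f" by blast
  from choice[OF this] obtain f
    where f: "\<And>n. f n \<in> ?V" "\<And>n. top_eigenvalue - 1 / real (Suc n) < energy (f n)" by blast
  have "(\<lambda>n. energy (f n)) \<longlonglongrightarrow> top_eigenvalue"
  proof (rule tendsto_sandwich)
    show "(\<lambda>n. top_eigenvalue - 1 / real (Suc n)) \<longlonglongrightarrow> top_eigenvalue"
      using tendsto_diff[OF tendsto_const[of top_eigenvalue] LIMSEQ_Suc[OF lim_1_over_n]] by simp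
    show "eventually (\<lambda>n. top_eigenvalue - 1 / real (Suc n) \<le> energy (f n)) sequentially"
      using f(2) by (intro always_eventually allI less_imp_le)
    show "eventually (\<lambda>n. energy (f n) \<le> top_eigenvalue) sequentially"
      using f(1) by (intro always_eventually allI energy_le_top_eigenvalue) auto
  qed (rule tendsto_const)
  with f(1) that show thesis by blast
qed

text \<open>
  Along a maximizing sequence \<open>\<parallel>gram (f n) - \<lambda> f n\<parallel>\<^sup>2 \<le> \<lambda>\<^sup>2 - \<lambda> energy (f n)\<close> tends to \<open>0\<close>, by
  \<open>gram_norm_le\<close>. Applying \<open>gram\<close> turns this into pointwise convergence, so that a pointwise limit of
  a subsequence of \<open>gram (f n)\<close> satisfies the eigenvalue equation at every point.
\<close>

lemma ex_eigenfunction: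
  assumes pos: "top_eigenvalue > 0"
  obtains h where "mean_zero h" "\<And>x. x \<in> carrier G \<Longrightarrow> gram h x = top_eigenvalue * h x" "inner_L2 M h h > 0"
proof -
  obtain f where f: "\<And>n. mean_zero (f n)" and f1: "\<And>n. inner_L2 M (f n) (f n) \<le> 1"
    and en: "(\<lambda>n. energy (f n)) \<longlonglongrightarrow> top_eigenvalue"
    by (rule ex_maximizing_sequence) blast
  note bf = mean_zero_bounded_measurable[OF f]
  note bS = gram_bounded_measurable[OF bf]
  obtain k :: "nat \<Rightarrow> nat" where k: "strict_mono k"
    and cv: "\<And>x. x \<in> carrier G \<Longrightarrow> convergent (\<lambda>n. gram (f (k n)) x)"
    by (rule gram_convergent_subsequence[of f, OF bf f1]) blast
  define F where "F n = gram (f (k n))" for n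
  define h where "h x = lim (\<lambda>n. F n x)" for x
  have lim: "(\<lambda>n. F n x) \<longlonglongrightarrow> h x" if "x \<in> carrier G" for x
    using cv[OF that] unfolding h_def F_def by (rule convergent_LIMSEQ_iff[THEN iffD1])
  have bF: "bounded_measurable M (F n)" for n
    unfolding F_def by (rule bS)
  have F1: "\<bar>F n x\<bar> \<le> 1" if "x \<in> carrier G" for n x
  proof -
    have "\<bar>F n x\<bar> \<le> sqrt (inner_L2 M (f (k n)) (f (k n)))"
      unfolding F_def by (rule gram_bound_norm[OF bf that])
    also have "\<dots> \<le> 1" using f1 by simp
    finally show ?thesis .
  qed
  have FF: "\<bar>F n x * F n x\<bar> \<le> 1" if "x \<in> carrier G" for n x
    using F1[OF that, of n] mult_mono[of "\<bar>F n x\<bar>" 1 "\<bar>F n x\<bar>" 1] by (simp add: abs_mult)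
  have bh: "bounded_measurable M h" and int: "(\<lambda>n. \<integral>x. F n x \<partial>M) \<longlonglongrightarrow> (\<integral>x. h x \<partial>M)"
    using bounded_convergence[where f = F and C = 1 and h = h] bF F1 lim by (simp_all add: space_M)
  have "(\<integral>x. F n x \<partial>M) = 0" for n
    using gram_mean_zero[OF f] unfolding F_def mean_zero_def by blast
  then have "(\<integral>x. h x \<partial>M) = 0"
    using int by (simp add: LIMSEQ_const_iff)
  then have mz: "mean_zero h" using bh by (simp add: mean_zero_def)
  have en_k: "(\<lambda>n. energy (f (k n))) \<longlonglongrightarrow> top_eigenvalue"
    using LIMSEQ_subseq_LIMSEQ[OF en k] by (simp add: o_def)
  have "gram h x = top_eigenvalue * h x" if x: "x \<in> carrier G" for x
  proof -
    have "(\<lambda>n. gram (F n) x) \<longlonglongrightarrow> gram h x"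
      by (rule gram_tendsto[OF x bF F1 lim])
    then have "(\<lambda>n. gram (F n) x - top_eigenvalue * F n x) \<longlonglongrightarrow> gram h x - top_eigenvalue * h x"
      by (intro tendsto_diff tendsto_mult tendsto_const lim x)
    moreover have "(\<lambda>n. gram (F n) x - top_eigenvalue * F n x) \<longlonglongrightarrow> 0"
    proof (rule Lim_null_comparison)
      have "\<bar>gram (F n) x - top_eigenvalue * F n x\<bar> \<le> sqrt (top_eigenvalue\<^sup>2 - top_eigenvalue * energy (f (k n)))" for n
      proof -
        let ?g = "\<lambda>y. F n y - top_eigenvalue * f (k n) y"
        have bl: "bounded_measurable M (\<lambda>y. top_eigenvalue * f (k n) y)"
          by (rule bounded_measurable_cmult[OF bf])
        have "inner_L2 M (F n) (\<lambda>y. top_eigenvalue * f (k n) y) = top_eigenvalue * energy (f (k n))"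
          by (simp add: F_def inner_L2_cmult_right gram_adjoint[OF bf bf])
        then have "inner_L2 M ?g ?g
            = inner_L2 M (F n) (F n) - 2 * (top_eigenvalue * energy (f (k n))) + top_eigenvalue\<^sup>2 * inner_L2 M (f (k n)) (f (k n))"
          using inner_L2_diff_self[OF bF[of n] bl] by (simp add: inner_L2_cmult_both)
        also have "\<dots> \<le> top_eigenvalue * energy (f (k n)) - 2 * (top_eigenvalue * energy (f (k n))) + top_eigenvalue\<^sup>2 * 1"
          using gram_norm_le[OF f, of "k n"] mult_left_mono[OF f1[of "k n"] zero_le_power2[of top_eigenvalue]]
          by (simp add: F_def)
        finally have g: "inner_L2 M ?g ?g \<le> top_eigenvalue\<^sup>2 - top_eigenvalue * energy (f (k n))" by simp
        have "gram (F n) x - top_eigenvalue * F n x = gram ?g x"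
          using gram_diff_cmult[OF bF[of n] bf x] by (simp add: F_def)
        also have "\<bar>\<dots>\<bar> \<le> sqrt (inner_L2 M ?g ?g)"
          by (intro gram_bound_norm bounded_measurable_diff bF bl x)
        also have "\<dots> \<le> sqrt (top_eigenvalue\<^sup>2 - top_eigenvalue * energy (f (k n)))"
          using g by (rule real_sqrt_le_mono)
        finally show ?thesis .
      qed
      then show "eventually (\<lambda>n. norm (gram (F n) x - top_eigenvalue * F n x)
          \<le> sqrt (top_eigenvalue\<^sup>2 - top_eigenvalue * energy (f (k n)))) sequentially"
        by simp
      have "(\<lambda>n. sqrt (top_eigenvalue\<^sup>2 - top_eigenvalue * energy (f (k n)))) \<longlonglongrightarrow> sqrt (top_eigenvalue\<^sup>2 - top_eigenvalue * top_eigenvalue)"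
        by (intro tendsto_real_sqrt tendsto_diff tendsto_mult tendsto_const en_k)
      then show "(\<lambda>n. sqrt (top_eigenvalue\<^sup>2 - top_eigenvalue * energy (f (k n)))) \<longlonglongrightarrow> 0"
        by (simp add: power2_eq_square)
    qed
    ultimately have "gram h x - top_eigenvalue * h x = 0" by (rule LIMSEQ_unique)
    then show ?thesis by simp
  qed
  \<comment> \<open>the limit keeps norm at least \<open>\<lambda>\<close>, as \<open>energy f = \<langle>gram f, f\<rangle> \<le> \<parallel>gram f\<parallel>\<close> in the unit ball\<close>
  moreover have "inner_L2 M h h > 0"
  proof -
    have "(\<lambda>n. inner_L2 M (F n) (F n)) \<longlonglongrightarrow> inner_L2 M h h"
      unfolding inner_L2_def
    proof (rule bounded_convergence(2)[where C = 1])
      show "bounded_measurable M (\<lambda>x. F n x * F n x)" for n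
        by (intro bounded_measurable_mult bF)
      show "\<bar>F n x * F n x\<bar> \<le> 1" if "x \<in> space M" for n x
        using FF that by (simp add: space_M)
      show "(\<lambda>n. F n x * F n x) \<longlonglongrightarrow> h x * h x" if "x \<in> space M" for x
        using lim that by (intro tendsto_mult) (simp_all add: space_M)
    qed
    moreover have "(\<lambda>n. (energy (f (k n)))\<^sup>2) \<longlonglongrightarrow> top_eigenvalue\<^sup>2"
      by (intro tendsto_power en_k)
    moreover have "(energy (f (k n)))\<^sup>2 \<le> inner_L2 M (F n) (F n)" for n
    proof -
      have "(energy (f (k n)))\<^sup>2 \<le> inner_L2 M (F n) (F n) * inner_L2 M (f (k n)) (f (k n))"
        using inner_L2_Cauchy_Schwarz[OF bF bf] gram_adjoint[OF bf bf] by (simp add: F_def)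
      also have "\<dots> \<le> inner_L2 M (F n) (F n) * 1"
        by (intro mult_left_mono f1 inner_L2_self_nonneg)
      finally show ?thesis by simp
    qed
    ultimately have "top_eigenvalue\<^sup>2 \<le> inner_L2 M h h"
      by (intro LIMSEQ_le) auto
    moreover have "top_eigenvalue\<^sup>2 > 0" using pos by simp
    ultimately show ?thesis by linarith
  qed
  ultimately show thesis using mz that by blast
qed

end

section \<open>The eigenspace as a representation\<close>

lemma hom_GL_I:
  assumes "group G"
    and carrier: "\<And>g. g \<in> carrier G \<Longrightarrow> \<rho> g \<in> carrier_mat n n"
    and mult: "\<And>g h. g \<in> carrier G \<Longrightarrow> h \<in> carrier G \<Longrightarrow> \<rho> (g \<otimes>\<^bsub>G\<^esub> h) = \<rho> g * \<rho> h"
    and one: "\<rho> \<one>\<^bsub>G\<^esub> = 1\<^sub>m n"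
  shows "\<rho> \<in> hom G (GL n)"
proof -
  interpret group G by fact
  have "\<rho> g \<in> Units (ring_mat TYPE(complex) n ())" if g: "g \<in> carrier G" for g
  proof -
    have "\<rho> (inv\<^bsub>G\<^esub> g) * \<rho> g = 1\<^sub>m n" "\<rho> g * \<rho> (inv\<^bsub>G\<^esub> g) = 1\<^sub>m n"
      using g one by (simp_all flip: mult)
    moreover have "\<rho> g \<in> carrier_mat n n" "\<rho> (inv\<^bsub>G\<^esub> g) \<in> carrier_mat n n"
      using g carrier by simp_all
    ultimately show ?thesis
      unfolding Units_def ring_mat_simps by blast
  qed
  then show ?thesis
    unfolding hom_def GL_def units_of_carrier units_of_mult ring_mat_simps
    using mult by blast
qed

context haar_group_set
begin

text \<open>
  The equation is required at every point of \<open>G\<close>, not almost everywhere. Eigenfunctions for a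
  positive eigenvalue are then continuous, and those of norm \<open>0\<close> vanish identically.
\<close>

definition eigenspace :: "('a \<Rightarrow> real) set" where
  "eigenspace = {f. mean_zero f \<and> (\<forall>x\<in>carrier G. gram f x = top_eigenvalue * f x)}"

definition orthonormal :: "nat \<Rightarrow> (nat \<Rightarrow> 'a \<Rightarrow> real) \<Rightarrow> bool" where
  "orthonormal n e \<longleftrightarrow> (\<forall>i<n. \<forall>j<n. inner_L2 M (e i) (e j) = (if i = j then 1 else 0))"

lemma orthonormalD:
  "orthonormal n e \<Longrightarrow> i < n \<Longrightarrow> j < n \<Longrightarrow> inner_L2 M (e i) (e j) = (if i = j then 1 else 0)"
  by (simp add: orthonormal_def)

lemma eigenspace_mean_zero: "f \<in> eigenspace \<Longrightarrow> mean_zero f"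
  by (simp add: eigenspace_def)

lemma eigenspace_bounded_measurable: "f \<in> eigenspace \<Longrightarrow> bounded_measurable M f"
  by (simp add: eigenspace_def mean_zero_def)

lemma eigenspace_gram: "f \<in> eigenspace \<Longrightarrow> x \<in> carrier G \<Longrightarrow> gram f x = top_eigenvalue * f x"
  by (simp add: eigenspace_def)

lemma energy_eigenspace:
  assumes f: "f \<in> eigenspace"
  shows "energy f = top_eigenvalue * inner_L2 M f f"
proof -
  note bf = eigenspace_bounded_measurable[OF f]
  have "energy f = inner_L2 M (gram f) f"
    using gram_adjoint[OF bf bf] by simp
  also have "\<dots> = inner_L2 M (\<lambda>x. top_eigenvalue * f x) f"
    by (rule inner_L2_cong) (simp_all add: eigenspace_gram[OF f] space_M)
  finally show ?thesis by (simp add: inner_L2_cmult)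
qed

lemma gram_cmult: "gram (\<lambda>y. c * f y) x = c * gram f x"
proof -
  have "conv_A (\<lambda>y. c * f y) = (\<lambda>x. c * conv_A f x)"
    by (rule ext) (rule conv_cmult)
  then show ?thesis by (simp add: gram_def conv_cmult)
qed

lemma eigenspace_cmult: "f \<in> eigenspace \<Longrightarrow> (\<lambda>x. c * f x) \<in> eigenspace"
  by (simp add: eigenspace_def mean_zero_cmult gram_cmult)

lemma eigenspace_diff_cmult:
  assumes f: "f \<in> eigenspace" and g: "g \<in> eigenspace"
  shows "(\<lambda>x. f x - c * g x) \<in> eigenspace"
proof -
  note bf = eigenspace_bounded_measurable[OF f] and bg = eigenspace_bounded_measurable[OF g]
  have "(\<integral>x. f x - c * g x \<partial>M) = (\<integral>x. f x \<partial>M) - c * (\<integral>x. g x \<partial>M)"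
    using bounded_measurable_integrable[OF bf] bounded_measurable_integrable[OF bg] by simp
  also have "\<dots> = 0"
    using eigenspace_mean_zero[OF f] eigenspace_mean_zero[OF g] by (simp add: mean_zero_def)
  finally have "mean_zero (\<lambda>x. f x - c * g x)"
    using bounded_measurable_diff[OF bf bounded_measurable_cmult[OF bg]]
    by (simp add: mean_zero_def)
  moreover have "gram (\<lambda>x. f x - c * g x) x = top_eigenvalue * (f x - c * g x)" if "x \<in> carrier G" for x
    using gram_diff_cmult[OF bf bg that] eigenspace_gram[OF f that] eigenspace_gram[OF g that]
    by (simp add: algebra_simps)
  ultimately show ?thesis by (simp add: eigenspace_def)
qed

lemma eigenspace_diff_sum:
  fixes n :: nat
  assumes f: "f \<in> eigenspace" and e: "\<And>i. i < n \<Longrightarrow> e i \<in> eigenspace"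
  shows "(\<lambda>x. f x - (\<Sum>i<n. c i * e i x)) \<in> eigenspace"
  using e
proof (induction n)
  case 0
  then show ?case using f by simp
next
  case (Suc n)
  have "(\<lambda>x. f x - (\<Sum>i<n. c i * e i x)) \<in> eigenspace"
    using Suc by simp
  from eigenspace_diff_cmult[OF this Suc.prems[of n], of "c n"]
  show ?case by (simp add: algebra_simps)
qed

lemma eigenspace_right_translate:
  assumes f: "f \<in> eigenspace" and g: "g \<in> carrier G"
  shows "(\<lambda>x. f (x \<otimes> g)) \<in> eigenspace"
proof -
  note bf = eigenspace_bounded_measurable[OF f]
  have "mean_zero (\<lambda>x. f (x \<otimes> g))"
    using eigenspace_mean_zero[OF f] bounded_measurable_compose[OF bf measurable_right_translate[OF g]]
      integral_right_translate[OF g bounded_measurable_measurable[OF bf]]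
    by (simp add: mean_zero_def)
  moreover have "gram (\<lambda>x. f (x \<otimes> g)) x = top_eigenvalue * f (x \<otimes> g)" if x: "x \<in> carrier G" for x
  proof -
    have "gram (\<lambda>x. f (x \<otimes> g)) x = conv (set_inv A) (\<lambda>y. conv_A f (y \<otimes> g)) x"
      unfolding gram_def by (rule conv_cong) (rule conv_right_translate[OF A bf g])
    also have "\<dots> = gram f (x \<otimes> g)"
      unfolding gram_def by (rule conv_right_translate[OF A' conv_bounded_measurable[OF A bf] g x])
    finally show ?thesis using eigenspace_gram[OF f] x g by simp
  qed
  ultimately show ?thesis by (simp add: eigenspace_def)
qed

lemma gram_sequentially_continuous:
  assumes f: "bounded_measurable M f" and s: "\<And>n. s n \<in> carrier G" and lim: "limitin T s x sequentially"
  shows "(\<lambda>n. gram f (s n)) \<longlonglongrightarrow> gram f x"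
proof -
  have x: "x \<in> carrier G"
    using lim by (simp add: limitin_def topspace_eq)
  note bc = conv_bounded_measurable[OF A f]
  have "(\<lambda>n. gram f (s n) - gram f x) \<longlonglongrightarrow> 0"
  proof (rule Lim_null_comparison)
    have "\<bar>gram f (s n) - gram f x\<bar> \<le> sqrt (inner_L2 M f f) * translate_dist (set_inv A) (s n) x" for n
      unfolding gram_def by (rule conv_equicontinuous[OF A' bc conv_bound_norm[OF A f] s x])
    then show "eventually (\<lambda>n. norm (gram f (s n) - gram f x)
        \<le> sqrt (inner_L2 M f f) * translate_dist (set_inv A) (s n) x) sequentially"
      by simp
    show "(\<lambda>n. sqrt (inner_L2 M f f) * translate_dist (set_inv A) (s n) x) \<longlonglongrightarrow> 0"
      by (rule tendsto_mult_right_zero[OF translate_dist_tendsto[OF A' s lim]])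
  qed
  then show ?thesis by (rule LIM_zero_cancel)
qed

text \<open>
  Bessel's inequality for the kernel functions \<open>y \<mapsto> 1\<^sub>A(x y\<^sup>-\<^sup>1)\<close>, integrated over \<open>x\<close>: the sum of the
  squared singular values is at most the squared Hilbert-Schmidt norm \<open>\<mu>(A)\<close>.
\<close>

lemma orthonormal_eigenspace_bound:
  assumes e: "\<And>i. i < n \<Longrightarrow> e i \<in> eigenspace" and orth: "orthonormal n e"
  shows "real n * top_eigenvalue \<le> measure M A"
proof -
  have be: "bounded_measurable M (e i)" if "i < n" for i
    using e[OF that] by (rule eigenspace_bounded_measurable)
  have bc: "bounded_measurable M (\<lambda>x. conv_A (e i) x * conv_A (e i) x)" if "i < n" for i
    by (intro bounded_measurable_mult conv_bounded_measurable A be that)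
  have "real n * top_eigenvalue = (\<Sum>i<n. energy (e i))"
    using energy_eigenspace[OF e] orthonormalD[OF orth] by simp
  also have "\<dots> = (\<integral>x. (\<Sum>i<n. conv_A (e i) x * conv_A (e i) x) \<partial>M)"
    unfolding inner_L2_def using bc
    by (subst Bochner_Integration.integral_sum) (auto intro: bounded_measurable_integrable)
  also have "\<dots> \<le> (\<integral>x. measure M A \<partial>M)"
  proof (rule integral_mono)
    show "integrable M (\<lambda>x. \<Sum>i<n. conv_A (e i) x * conv_A (e i) x)"
      using bc by (intro bounded_measurable_integrable bounded_measurable_sum) auto
    fix x assume "x \<in> space M"
    then have x: "x \<in> carrier G" by (simp add: space_M)
    show "(\<Sum>i<n. conv_A (e i) x * conv_A (e i) x) \<le> measure M A"
      using inner_L2_Bessel[OF bounded_measurable_kernel[OF A x] be orthonormalD[OF orth]]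
      by (simp add: conv_eq_inner inner_kernel_self[OF A x] power2_eq_square)
  qed simp
  also have "\<dots> = measure M A" by (simp add: space_M measure_M)
  finally show ?thesis .
qed

context
  assumes top_eigenvalue_pos: "top_eigenvalue > 0"
begin

lemma eigenspace_norm_zero:
  assumes f: "f \<in> eigenspace" and "inner_L2 M f f = 0" and x: "x \<in> carrier G"
  shows "f x = 0"
  using gram_bound_norm[OF eigenspace_bounded_measurable[OF f] x] eigenspace_gram[OF f x] assms(2) top_eigenvalue_pos
  by simp

lemma eigenspace_normalize:
  assumes "f \<in> eigenspace" "inner_L2 M f f > 0"
  obtains c where "inner_L2 M (\<lambda>x. c * f x) (\<lambda>x. c * f x) = 1"
proof
  show "inner_L2 M (\<lambda>x. 1 / sqrt (inner_L2 M f f) * f x) (\<lambda>x. 1 / sqrt (inner_L2 M f f) * f x) = 1"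
    unfolding inner_L2_cmult_both using assms(2) by (simp add: power_divide)
qed

text \<open>
  The eigenspace has finite dimension, by the bound just proved; a longest orthonormal family
  spans it, as a nonzero residual could be normalized and appended.
\<close>

lemma ex_orthonormal_basis:
  obtains n e where "n > 0" "\<And>i. i < n \<Longrightarrow> e i \<in> eigenspace" "orthonormal n e"
    "\<And>f x. f \<in> eigenspace \<Longrightarrow> x \<in> carrier G \<Longrightarrow> f x = (\<Sum>i<n. inner_L2 M f (e i) * e i x)"
proof -
  define P where "P n \<longleftrightarrow> (\<exists>e. (\<forall>i<n. e i \<in> eigenspace) \<and> orthonormal n e)" for n
  have bound: "n \<le> nat \<lfloor>measure M A / top_eigenvalue\<rfloor>" if Pn: "P n" for n
  proof -
    obtain e where "\<forall>i<n. e i \<in> eigenspace" "orthonormal n e"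
      using Pn unfolding P_def by blast
    then have "real n * top_eigenvalue \<le> measure M A"
      using orthonormal_eigenspace_bound by blast
    then have "real n \<le> measure M A / top_eigenvalue"
      using top_eigenvalue_pos by (simp add: field_simps)
    then show ?thesis by (simp add: le_nat_floor)
  qed
  obtain h where h: "mean_zero h" "\<And>x. x \<in> carrier G \<Longrightarrow> gram h x = top_eigenvalue * h x" "inner_L2 M h h > 0"
    using ex_eigenfunction[OF top_eigenvalue_pos] by blast
  have hE: "h \<in> eigenspace" using h by (simp add: eigenspace_def)
  obtain c where c: "inner_L2 M (\<lambda>x. c * h x) (\<lambda>x. c * h x) = 1"
    using eigenspace_normalize[OF hE h(3)] by blast
  have P1: "P 1"
    unfolding P_def orthonormal_def
    by (rule exI[where x = "\<lambda>_ x. c * h x"]) (use eigenspace_cmult[OF hE] c in auto)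
  define n where "n = (GREATEST n. P n)"
  have Pn: "P n"
    unfolding n_def by (rule GreatestI_nat[of P 1, OF P1 bound])
  have greatest: "k \<le> n" if "P k" for k
    unfolding n_def by (rule Greatest_le_nat[of P k, OF that bound])
  obtain e where e: "\<And>i. i < n \<Longrightarrow> e i \<in> eigenspace" and orth: "orthonormal n e"
    using Pn unfolding P_def by blast
  have "f x = (\<Sum>i<n. inner_L2 M f (e i) * e i x)" if f: "f \<in> eigenspace" and x: "x \<in> carrier G" for f x
  proof -
    define r where "r = (\<lambda>x. f x - (\<Sum>i<n. inner_L2 M f (e i) * e i x))"
    have r: "r \<in> eigenspace"
      unfolding r_def by (rule eigenspace_diff_sum[OF f e])
    have bsum: "bounded_measurable M (\<lambda>x. inner_L2 M f (e i) * e i x)" if "i < n" for i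
      by (intro bounded_measurable_cmult eigenspace_bounded_measurable e that)
    have re: "inner_L2 M r (e j) = 0" if j: "j < n" for j
    proof -
      note bj = eigenspace_bounded_measurable[OF e[OF j]]
      have "inner_L2 M r (e j) = inner_L2 M f (e j)
          - inner_L2 M (\<lambda>x. \<Sum>i<n. inner_L2 M f (e i) * e i x) (e j)"
        unfolding r_def using bsum
        by (intro inner_L2_diff bounded_measurable_sum eigenspace_bounded_measurable[OF f] bj) auto
      also have "inner_L2 M (\<lambda>x. \<Sum>i<n. inner_L2 M f (e i) * e i x) (e j)
          = (\<Sum>i<n. inner_L2 M f (e i) * inner_L2 M (e i) (e j))"
        using bsum bj by (subst inner_L2_sum) (auto simp: inner_L2_cmult)
      also have "\<dots> = (\<Sum>i<n. if i = j then inner_L2 M f (e i) else 0)"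
        by (rule sum.cong) (use orthonormalD[OF orth _ j] in auto)
      also have "\<dots> = inner_L2 M f (e j)" using j by simp
      finally show ?thesis by simp
    qed
    have "inner_L2 M r r = 0"
    proof (rule ccontr)
      assume "inner_L2 M r r \<noteq> 0"
      then have "inner_L2 M r r > 0" using inner_L2_self_nonneg[of M r] by simp
      then obtain c where c: "inner_L2 M (\<lambda>x. c * r x) (\<lambda>x. c * r x) = 1"
        using eigenspace_normalize[OF r] by blast
      define e' where "e' i = (if i < n then e i else (\<lambda>x. c * r x))" for i
      have c0: "inner_L2 M (\<lambda>x. c * r x) (e i) = 0" "inner_L2 M (e i) (\<lambda>x. c * r x) = 0"
        if "i < n" for i
        using re[OF that] inner_L2_commute[of M "e i" r] by (simp_all add: inner_L2_cmult inner_L2_cmult_right)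
      have "orthonormal (Suc n) e'"
        unfolding orthonormal_def
      proof (intro allI impI)
        fix i j assume "i < Suc n" "j < Suc n"
        then show "inner_L2 M (e' i) (e' j) = (if i = j then 1 else 0)"
          using c c0 orthonormalD[OF orth] by (cases "i < n"; cases "j < n") (auto simp: e'_def)
      qed
      moreover have "\<forall>i<Suc n. e' i \<in> eigenspace"
        using e eigenspace_cmult[OF r] by (simp add: e'_def)
      ultimately have "P (Suc n)" unfolding P_def by blast
      then show False using greatest by fastforce
    qed
    from eigenspace_norm_zero[OF r this x] show ?thesis by (simp add: r_def)
  qed
  moreover have "n > 0" using greatest[OF P1] by simp
  ultimately show thesis using that e orth by blast
qed

text \<open>
  \<open>G\<close> acts on the eigenspace by right translation, and in an orthonormal basis this is a matrix
  representation. A trivial action would make every eigenfunction constant, hence zero because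
  it has mean zero.
\<close>

lemma ex_nontrivial_representation:
  obtains n \<rho> where "continuous_representation G T n \<rho>" "nontrivial_representation G n \<rho>"
    "real n * top_eigenvalue \<le> measure M A"
proof -
  obtain n e where n: "n > 0" and e: "\<And>i. i < n \<Longrightarrow> e i \<in> eigenspace" and orth: "orthonormal n e"
    and expand: "\<And>f x. f \<in> eigenspace \<Longrightarrow> x \<in> carrier G \<Longrightarrow> f x = (\<Sum>i<n. inner_L2 M f (e i) * e i x)"
    using ex_orthonormal_basis by blast
  have be: "bounded_measurable M (e i)" if "i < n" for i
    using e[OF that] by (rule eigenspace_bounded_measurable)
  \<comment> \<open>column \<open>j\<close> holds the coordinates of the translate of \<open>e j\<close>, so that products keep their order\<close>
  define r where "r g i j = inner_L2 M (\<lambda>x. e j (x \<otimes> g)) (e i)" for g i j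
  define \<rho> where "\<rho> g = mat n n (\<lambda>(i, j). complex_of_real (r g i j))" for g
  have expand_translate: "e j (x \<otimes> g) = (\<Sum>i<n. r g i j * e i x)"
    if "j < n" "g \<in> carrier G" "x \<in> carrier G" for j g x
    using expand[OF eigenspace_right_translate[OF e[OF that(1)] that(2)] that(3)]
    by (simp add: r_def)
  have r_mult: "r (g \<otimes> h) i j = (\<Sum>k<n. r g i k * r h k j)"
    if g: "g \<in> carrier G" and h: "h \<in> carrier G" and i: "i < n" and j: "j < n" for g h i j
  proof -
    have "r (g \<otimes> h) i j = inner_L2 M (\<lambda>x. \<Sum>k<n. r h k j * e k (x \<otimes> g)) (e i)"
      unfolding r_def[of "g \<otimes> h"]
    proof (rule inner_L2_cong)
      fix x assume "x \<in> space M"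
      then have x: "x \<in> carrier G" by (simp add: space_M)
      then show "e j (x \<otimes> (g \<otimes> h)) = (\<Sum>k<n. r h k j * e k (x \<otimes> g))"
        using expand_translate[OF j h, of "x \<otimes> g"] g h by (simp add: m_assoc)
    qed simp
    also have "\<dots> = (\<Sum>k<n. inner_L2 M (\<lambda>x. r h k j * e k (x \<otimes> g)) (e i))"
      using be i measurable_right_translate[OF g]
      by (intro inner_L2_sum bounded_measurable_cmult bounded_measurable_compose[OF be]) auto
    finally show ?thesis unfolding inner_L2_cmult by (simp only: r_def[of g] mult.commute)
  qed
  have r_one: "r \<one> i j = (if i = j then 1 else 0)" if "i < n" "j < n" for i j
  proof -
    have "r \<one> i j = inner_L2 M (e j) (e i)"
      unfolding r_def by (rule inner_L2_cong) (simp_all add: space_M)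
    then show ?thesis using orthonormalD[OF orth that(2,1)] by auto
  qed
  have "\<rho> \<in> hom G (GL n)"
  proof (rule hom_GL_I)
    show "group G" by (rule group_axioms)
    show "\<rho> g \<in> carrier_mat n n" for g by (simp add: \<rho>_def)
    show "\<rho> (g \<otimes> h) = \<rho> g * \<rho> h" if "g \<in> carrier G" "h \<in> carrier G" for g h
    proof (rule eq_matI)
      fix i j assume "i < dim_row (\<rho> g * \<rho> h)" "j < dim_col (\<rho> g * \<rho> h)"
      then have ij: "i < n" "j < n" by (simp_all add: \<rho>_def)
      then show "\<rho> (g \<otimes> h) $$ (i, j) = (\<rho> g * \<rho> h) $$ (i, j)"
        using r_mult[OF that ij] by (simp add: \<rho>_def scalar_prod_def atLeast0LessThan)
    qed (simp_all add: \<rho>_def)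
    show "\<rho> \<one> = 1\<^sub>m n"
      by (rule eq_matI) (simp_all add: \<rho>_def r_one)
  qed
  moreover have "continuous_map T euclidean (\<lambda>g. \<rho> g $$ (i, j))" if i: "i < n" and j: "j < n" for i j
  proof (rule sequentially_continuous_imp_continuous_map)
    show "first_countable T"
      using second_countable by (rule second_countable_imp_first_countable)
    fix g s assume g: "g \<in> topspace T" and s: "\<And>k. s k \<in> topspace T" and lim: "limitin T s g sequentially"
    have gG: "g \<in> carrier G" and sG: "s k \<in> carrier G" for k
      using g s topspace_eq by auto
    obtain C where C: "\<And>x. x \<in> space M \<Longrightarrow> \<bar>e j x\<bar> \<le> C"
      using be[OF j] by (rule bounded_measurableE) blast
    obtain D where D: "D \<ge> 0" "\<And>x. x \<in> space M \<Longrightarrow> \<bar>e i x\<bar> \<le> D"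
      using be[OF i] by (rule bounded_measurableE) blast
    have "(\<lambda>k. r (s k) i j) \<longlonglongrightarrow> r g i j"
      unfolding r_def inner_L2_def
    proof (rule bounded_convergence(2)[where C = "C * D"])
      show "bounded_measurable M (\<lambda>x. e j (x \<otimes> s k) * e i x)" for k
        by (intro bounded_measurable_mult be i
            bounded_measurable_compose[OF be[OF j] measurable_right_translate[OF sG]])
      fix x assume "x \<in> space M"
      then have x: "x \<in> carrier G" by (simp add: space_M)
      show "\<bar>e j (x \<otimes> s k) * e i x\<bar> \<le> C * D" for k
        unfolding abs_mult using C[of "x \<otimes> s k"] D(1) D(2)[of x] x sG[of k]
        by (intro mult_mono) (auto simp: space_M)
      have lim': "limitin T (\<lambda>k. x \<otimes> s k) (x \<otimes> g) sequentially"
        using continuous_map_limit[OF continuous_left_translate[OF x] lim] by (simp add: o_def)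
      have "(\<lambda>k. gram (e j) (x \<otimes> s k)) \<longlonglongrightarrow> gram (e j) (x \<otimes> g)"
        by (rule gram_sequentially_continuous[OF be[OF j] _ lim']) (use x sG in simp)
      then have "(\<lambda>k. top_eigenvalue * e j (x \<otimes> s k)) \<longlonglongrightarrow> top_eigenvalue * e j (x \<otimes> g)"
        using eigenspace_gram[OF e[OF j]] x sG gG by simp
      from tendsto_divide[OF this tendsto_const, of top_eigenvalue]
      have "(\<lambda>k. e j (x \<otimes> s k)) \<longlonglongrightarrow> e j (x \<otimes> g)"
        using top_eigenvalue_pos by simp
      then show "(\<lambda>k. e j (x \<otimes> s k) * e i x) \<longlonglongrightarrow> e j (x \<otimes> g) * e i x"
        by (rule tendsto_mult[OF _ tendsto_const])
    qed
    then have "(\<lambda>k. complex_of_real (r (s k) i j)) \<longlonglongrightarrow> complex_of_real (r g i j)"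
      by (rule tendsto_of_real)
    then show "(\<lambda>k. \<rho> (s k) $$ (i, j)) \<longlonglongrightarrow> \<rho> g $$ (i, j)"
      using i j by (simp add: \<rho>_def)
  qed
  ultimately have "continuous_representation G T n \<rho>"
    by (simp add: continuous_representation_def)
  moreover have "nontrivial_representation G n \<rho>"
  proof (rule ccontr)
    assume "\<not> ?thesis"
    then have triv: "\<rho> g = 1\<^sub>m n" if "g \<in> carrier G" for g
      using that by (auto simp: nontrivial_representation_def)
    have r0: "r g i 0 = (if i = 0 then 1 else 0)" if "g \<in> carrier G" "i < n" for g i
    proof -
      have "\<rho> g $$ (i, 0) = (1\<^sub>m n :: complex mat) $$ (i, 0)" using triv[OF that(1)] by simp
      then show ?thesis using that(2) n by (auto simp: \<rho>_def split: if_splits)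
    qed
    have const: "e 0 g = e 0 \<one>" if g: "g \<in> carrier G" for g
    proof -
      have "e 0 (\<one> \<otimes> g) = (\<Sum>i<n. r g i 0 * e i \<one>)"
        by (rule expand_translate[OF n g]) simp
      also have "\<dots> = (\<Sum>i<n. if i = 0 then e i \<one> else 0)"
        by (rule sum.cong) (use r0[OF g] in auto)
      also have "\<dots> = e 0 \<one>" using n by simp
      finally show ?thesis using g by simp
    qed
    have "0 = (\<integral>x. e 0 x \<partial>M)"
      using eigenspace_mean_zero[OF e[OF n]] by (simp add: mean_zero_def)
    also have "\<dots> = (\<integral>x. e 0 \<one> \<partial>M)"
      by (rule Bochner_Integration.integral_cong[OF refl]) (rule const, simp add: space_M)
    also have "\<dots> = e 0 \<one>" by (simp add: space_M measure_M)
    finally have zero: "e 0 x = 0" if "x \<in> carrier G" for x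
      using const[OF that] by simp
    have "inner_L2 M (e 0) (e 0) = inner_L2 M (\<lambda>_. 0) (\<lambda>_. 0)"
      by (rule inner_L2_cong) (simp_all add: zero space_M)
    then show False using orthonormalD[OF orth n n] by (simp add: inner_L2_def)
  qed
  moreover have "real n * top_eigenvalue \<le> measure M A"
    by (rule orthonormal_eigenspace_bound[OF e orth])
  ultimately show thesis by (rule that)
qed

end

lemma energy_le_of_min_dimension:
  assumes m: "m > 0"
    and rep: "\<And>n \<rho>. continuous_representation G T n \<rho> \<Longrightarrow> nontrivial_representation G n \<rho> \<Longrightarrow> m \<le> n"
    and f: "mean_zero f"
  shows "energy f \<le> measure M A / real m * inner_L2 M f f"
proof -
  have "real m * top_eigenvalue \<le> measure M A"
  proof (cases "top_eigenvalue > 0")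
    case True
    obtain n \<rho> where "continuous_representation G T n \<rho>" "nontrivial_representation G n \<rho>"
      and n: "real n * top_eigenvalue \<le> measure M A"
      by (rule ex_nontrivial_representation[OF True]) blast
    then have "real m * top_eigenvalue \<le> real n * top_eigenvalue"
      using rep True by (intro mult_right_mono) auto
    with n show ?thesis by linarith
  next
    case False
    then have "top_eigenvalue = 0" using top_eigenvalue_nonneg by simp
    then show ?thesis by simp
  qed
  then have "top_eigenvalue \<le> measure M A / real m"
    using m by (simp add: field_simps)
  then have "top_eigenvalue * inner_L2 M f f \<le> measure M A / real m * inner_L2 M f f"
    by (rule mult_right_mono[OF _ inner_L2_self_nonneg])
  with energy_le_top_eigenvalue_mult[OF f] show ?thesis by linarith
qed

end

section \<open>Passage to the completed measure\<close>

context haar_group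
begin

lemma AE_div_right:
  assumes "AE z in M. P z" and x: "x \<in> carrier G"
  shows "AE y in M. P (x \<otimes> inv y)"
proof -
  have "distr M M (\<lambda>y. x \<otimes> inv y) = distr (distr M M (\<lambda>y. inv y)) M (\<lambda>z. x \<otimes> z)"
    by (subst distr_distr[OF measurable_left_translate[OF x] measurable_inv]) (simp add: o_def)
  also have "\<dots> = M"
    by (simp add: distr_inv distr_left_translate[OF x])
  finally have "AE z in distr M M (\<lambda>y. x \<otimes> inv y). P z" by (rule ssubst) (rule assms(1))
  then show ?thesis by (rule AE_distrD[OF measurable_div_right[OF x]])
qed

lemma completion_ex_Borel_set:
  assumes "A \<in> sets (completion M)"
  obtains A\<^sub>0 where "A\<^sub>0 \<in> sets M" "AE x in M. x \<in> A \<longleftrightarrow> x \<in> A\<^sub>0"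
proof -
  obtain S N N' where A: "A = S \<union> N" "N \<subseteq> N'" and N': "N' \<in> null_sets M" and S: "S \<in> sets M"
    using assms by (rule sets_completionE)
  have "AE x in M. x \<notin> N'" using N' by (rule AE_not_in)
  then have "AE x in M. x \<in> A \<longleftrightarrow> x \<in> S"
    by eventually_elim (use A in auto)
  with S that show thesis by blast
qed

lemma measure_completion_eq_AE:
  assumes A: "A \<in> sets (completion M)" and A\<^sub>0: "A\<^sub>0 \<in> sets M" and ae: "AE x in M. x \<in> A \<longleftrightarrow> x \<in> A\<^sub>0"
  shows "measure (completion M) A = measure M A\<^sub>0"
  using measure_eq_AE[OF AE_completion[OF ae] A sets_completionI_sets[OF A\<^sub>0]] A\<^sub>0 by simp

text \<open>
  The map \<open>y \<mapsto> x y\<^sup>-\<^sup>1\<close> preserves the measure, so that null sets stay null under it and the value of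
  the convolution at every point \<open>x\<close> depends only on the classes of \<open>A\<close> and \<open>B\<close> modulo null sets.
\<close>

lemma convolution_completion_eq:
  assumes A\<^sub>0: "A\<^sub>0 \<in> sets M" "AE x in M. x \<in> A \<longleftrightarrow> x \<in> A\<^sub>0"
    and B\<^sub>0: "B\<^sub>0 \<in> sets M" "AE x in M. x \<in> B \<longleftrightarrow> x \<in> B\<^sub>0"
    and x: "x \<in> carrier G"
  shows "convolution G (completion M) (indicat_real A) (indicat_real B) x = conv A\<^sub>0 (indicat_real B\<^sub>0) x"
proof -
  define C where "C A B = {y \<in> space M. x \<otimes> inv y \<in> A \<and> y \<in> B}" for A B
  have C0: "C A\<^sub>0 B\<^sub>0 \<in> sets M"
  proof -
    have "C A\<^sub>0 B\<^sub>0 = ((\<lambda>y. x \<otimes> inv y) -` A\<^sub>0 \<inter> space M) \<inter> B\<^sub>0"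
      using sets.sets_into_space[OF B\<^sub>0(1)] by (auto simp: C_def)
    then show ?thesis
      using measurable_sets[OF measurable_div_right[OF x] A\<^sub>0(1)] B\<^sub>0(1) by simp
  qed
  have ae: "AE y in M. y \<in> C A B \<longleftrightarrow> y \<in> C A\<^sub>0 B\<^sub>0"
    using AE_div_right[OF A\<^sub>0(2) x] B\<^sub>0(2) by eventually_elim (auto simp: C_def)
  have C: "C A B \<in> sets (completion M)"
  proof (rule completion.in_sets_AE)
    show "AE y in completion M. y \<in> C A\<^sub>0 B\<^sub>0 \<longleftrightarrow> y \<in> C A B"
      using AE_completion[OF ae] by eventually_elim simp
  qed (use C0 in \<open>auto simp: C_def\<close>)
  have int: "(\<integral>y. indicat_real A (x \<otimes> inv y) * indicat_real B y \<partial>N) = measure N (C A B)"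
    if "space N = space M" "C A B \<in> sets N" for N A B
  proof -
    have "(\<integral>y. indicat_real A (x \<otimes> inv y) * indicat_real B y \<partial>N) = (\<integral>y. indicat_real (C A B) y \<partial>N)"
      by (rule Bochner_Integration.integral_cong) (auto simp: C_def indicator_def that)
    also have "\<dots> = measure N (C A B)"
      using sets.sets_into_space[OF that(2)] by (simp add: Int_absorb2)
    finally show ?thesis .
  qed
  show ?thesis
    unfolding convolution_def using int[OF _ C] int[OF _ C0] measure_completion_eq_AE[OF C C0 ae]
    by simp
qed

end

theorem corollary1:
  fixes G :: "('a, 'b) monoid_scheme" and T :: "'a topology"
    and M :: "'a measure" and m :: nat and A B :: "'a set"
  assumes "topological_group G T"
    and "compact_space T" and "Hausdorff_space T" and "second_countable T"
    and "normalized_haar_measure G T M"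
    and "m > 0"
    and "\<And>n \<rho>. continuous_representation G T n \<rho> \<Longrightarrow>
           nontrivial_representation G n \<rho> \<Longrightarrow> m \<le> n"
    and "A \<in> sets (completion M)" and "B \<in> sets (completion M)"
  shows "l2_norm (completion M)
           (\<lambda>x. convolution G (completion M) (indicat_real A) (indicat_real B) x
                 - measure (completion M) A * measure (completion M) B)
         \<le> sqrt (measure (completion M) A * measure (completion M) B / real m)"
proof -
  interpret haar_group G T M
    using assms(1,4,5) by (simp add: haar_group_def haar_group_axioms_def)
  obtain A\<^sub>0 where A\<^sub>0: "A\<^sub>0 \<in> sets M" "AE x in M. x \<in> A \<longleftrightarrow> x \<in> A\<^sub>0"
    using assms(8) by (rule completion_ex_Borel_set)
  obtain B\<^sub>0 where B\<^sub>0: "B\<^sub>0 \<in> sets M" "AE x in M. x \<in> B \<longleftrightarrow> x \<in> B\<^sub>0"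
    using assms(9) by (rule completion_ex_Borel_set)
  interpret haar_group_set G T M A\<^sub>0
    by unfold_locales (rule A\<^sub>0(1))
  have mA: "measure (completion M) A = measure M A\<^sub>0"
    by (rule measure_completion_eq_AE[OF assms(8) A\<^sub>0])
  have mB: "measure (completion M) B = measure M B\<^sub>0"
    by (rule measure_completion_eq_AE[OF assms(9) B\<^sub>0])
  define f where "f = (\<lambda>x. indicat_real B\<^sub>0 x - measure M B\<^sub>0)"
  note bB = bounded_measurable_indicator[OF B\<^sub>0(1)]
  have bf: "bounded_measurable M f"
    unfolding f_def by (intro bounded_measurable_diff bB bounded_measurable_const)
  have intB: "(\<integral>x. indicat_real B\<^sub>0 x \<partial>M) = measure M B\<^sub>0"
    using sets.sets_into_space[OF B\<^sub>0(1)] by (simp add: Int_absorb2)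
  have "(\<integral>x. f x \<partial>M) = 0"
    using bounded_measurable_integrable[OF bB] intB by (simp add: f_def space_M measure_M)
  then have mf: "mean_zero f" using bf by (simp add: mean_zero_def)
  have "inner_L2 M f f = inner_L2 M f (indicat_real B\<^sub>0)"
  proof -
    have "inner_L2 M f f = inner_L2 M (indicat_real B\<^sub>0) f - inner_L2 M (\<lambda>_. measure M B\<^sub>0) f"
      using inner_L2_diff[OF bB bounded_measurable_const bf] by (simp add: f_def)
    also have "inner_L2 M (\<lambda>_. measure M B\<^sub>0) f = 0"
      using mf by (simp add: inner_L2_def mean_zero_def)
    finally show ?thesis by (simp add: inner_L2_commute[of M f "indicat_real B\<^sub>0"])
  qed
  also have "\<dots> \<le> (\<integral>x. indicat_real B\<^sub>0 x \<partial>M)"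
    unfolding inner_L2_def
    by (intro integral_mono bounded_measurable_integrable bounded_measurable_mult bf bB)
      (auto simp: f_def indicator_def)
  also have "\<dots> = measure M B\<^sub>0" by (rule intB)
  finally have f_norm: "inner_L2 M f f \<le> measure M B\<^sub>0" .
  have eq: "convolution G (completion M) (indicat_real A) (indicat_real B) x
      - measure (completion M) A * measure (completion M) B = conv_A f x" if x: "x \<in> carrier G" for x
    unfolding convolution_completion_eq[OF A\<^sub>0 B\<^sub>0 x] mA mB f_def
    using conv_diff[OF A\<^sub>0(1) bB bounded_measurable_const x] conv_const[OF A\<^sub>0(1) x]
    by (simp add: mult.commute)
  have "(\<integral>x. (norm (convolution G (completion M) (indicat_real A) (indicat_real B) x
      - measure (completion M) A * measure (completion M) B))\<^sup>2 \<partial>completion M)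
      = (\<integral>x. conv_A f x * conv_A f x \<partial>completion M)"
    by (rule Bochner_Integration.integral_cong[OF refl])
      (simp only: eq space_completion space_M, simp add: power2_eq_square)
  also have "\<dots> = energy f"
    unfolding inner_L2_def
    by (intro integral_completion bounded_measurable_measurable bounded_measurable_mult
        conv_bounded_measurable A\<^sub>0(1) bf)
  also have "\<dots> \<le> measure M A\<^sub>0 / real m * inner_L2 M f f"
    by (rule energy_le_of_min_dimension[OF assms(6,7) mf])
  also have "\<dots> \<le> measure M A\<^sub>0 / real m * measure M B\<^sub>0"
    by (intro mult_left_mono f_norm) simp
  finally show ?thesis
    unfolding l2_norm_def mA mB by (intro real_sqrt_le_mono) simp
qed

end
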